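(* Let $(X,\mathcal{B},\mu)$ be a probability measure space, let $k\ge 1$ be an integer, and let $(T_\varepsilon)_{\varepsilon\in\{0,1\}^k\setminus\{0\}}$ be a family of $2^k-1$ weakly mixing measure preserving transformations on $(X,\mathcal{B},\mu)$, not necessarily commuting. Let $(f_\varepsilon)_{\varepsilon\in\{0,1\}^k\setminus\{0\}}$ be bounded measurable functions on $X$. Then for $\mu$-almost every $x\in X$, $$\lim_{N\to\infty}\frac{1}{N^k}\sum_{n_1,\dots,n_k=1}^N\ \prod_{\varepsilon\in\{0,1\}^k\setminus\{0\}} f_\varepsilon\bigl(T_\varepsilon^{\varepsilon_1n_1+\cdots+\varepsilon_kn_k}x\bigr)=\prod_{\varepsilon\in\{0,1\}^k\setminus\{0\}}\int_X f_\varepsilon\,d\mu .$$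
   Context: A measure preserving transformation $T$ of a probability space $(X,\mathcal{B},\mu)$ is weakly mixing if $\lim_{N\to\infty}\frac1N\sum_{n=1}^N|\mu(A\cap T^{-n}B)-\mu(A)\mu(B)|=0$ for all $A,B\in\mathcal{B}$; equivalently, $T$ is ergodic and its only eigenfunctions in $L^2(\mu)$ are the constants. Functions are scalar (complex) valued. *)

theory Defs
  imports "HOL-Probability.Probability"
begin

definition measure_preserving :: "'a measure \<Rightarrow> ('a \<Rightarrow> 'a) \<Rightarrow> bool" where
  "measure_preserving M T \<longleftrightarrow>
     T \<in> M \<rightarrow>\<^sub>M M \<and> (\<forall>A\<in>sets M. emeasure M (T -` A \<inter> space M) = emeasure M A)"

definition weakly_mixing :: "'a measure \<Rightarrow> ('a \<Rightarrow> 'a) \<Rightarrow> bool" where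
  "weakly_mixing M T \<longleftrightarrow> measure_preserving M T \<and>
     (\<forall>A\<in>sets M. \<forall>B\<in>sets M.
        (\<lambda>N. (1 / real N) * (\<Sum>n=1..N.
           \<bar>measure M (A \<inter> ((T ^^ n) -` B \<inter> space M)) - measure M A * measure M B\<bar>))
        \<longlonglongrightarrow> 0)"

text \<open>The nonzero vertices of the cube, as extensional functions on \<open>{1..k}\<close>, so that each vertex
  is represented exactly once and the set has \<open>2 ^ k - 1\<close> elements.\<close>

definition cube_nonzero :: "nat \<Rightarrow> (nat \<Rightarrow> nat) set" where
  "cube_nonzero k = ({1..k} \<rightarrow>\<^sub>E {0, 1}) - {\<lambda>i\<in>{1..k}. 0}"

end

theory Submission
  imports Defs
begin

text \<open>Splitting each \<open>f \<epsilon>\<close> into its mean and a function \<open>g \<epsilon>\<close> of mean zero and expanding the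
  product, it suffices that the averages of every nonempty product of the \<open>g \<epsilon>\<close> tend to \<open>0\<close>. Choose
  a vertex \<open>\<epsilon>\<close> of the product whose support \<open>J\<close> is maximal. Every other factor is constant in some
  variable \<open>n i\<close> with \<open>i \<in> J\<close>, so it suffices that the sequence \<open>c n = g \<epsilon> (T \<epsilon>\<^sup>n x)\<close> is uniform in
  the sense of \<open>cube_uniform\<close>: its averages over cubes of dimension \<open>card J\<close>, weighted by arbitrary
  bounded functions each of which is independent of one of the variables, tend to \<open>0\<close>. For almost every \<open>x\<close> this
  follows by induction on the dimension. In dimension one it is Birkhoff's theorem. In the
  induction step, van der Corput's inequality replaces \<open>c\<close> by the products
  \<open>c (n + r) * cnj (c (n + s))\<close>, which again come from bounded functions along the orbit of \<open>x\<close>; after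
  subtracting their means they are covered by the induction hypothesis, and the means are small on
  average because \<open>T \<epsilon>\<close> is weakly mixing.\<close>

subsection \<open>Birkhoff's theorem for bounded functions\<close>

lemma measure_preservingD:
  assumes "measure_preserving M T"
  shows "T \<in> M \<rightarrow>\<^sub>M M" and "distr M M T = M"
proof -
  show T: "T \<in> M \<rightarrow>\<^sub>M M"
    using assms by (simp add: measure_preserving_def)
  show "distr M M T = M"
    using assms T by (intro measure_eqI) (auto simp: measure_preserving_def emeasure_distr)
qed

lemma measure_preserving_funpow:
  assumes "measure_preserving M T"
  shows "measure_preserving M (T ^^ n)"
proof (induction n)
  case 0
  then show ?case
    by (auto simp: measure_preserving_def)
next
  case (Suc n)
  note T = measure_preservingD[OF assms] and Tn = measure_preservingD[OF Suc]
  have "emeasure M ((T ^^ Suc n) -` A \<inter> space M) = emeasure M A" if A: "A \<in> sets M" for A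
  proof -
    have "(T ^^ Suc n) -` A \<inter> space M = (T ^^ n) -` (T -` A \<inter> space M) \<inter> space M"
      using measurable_space[OF Tn(1)] by auto
    moreover have "T -` A \<inter> space M \<in> sets M"
      using T(1) A by (rule measurable_sets)
    ultimately show ?thesis
      using assms Suc A unfolding measure_preserving_def by metis
  qed
  moreover have "T ^^ Suc n \<in> M \<rightarrow>\<^sub>M M"
    unfolding funpow.simps(2) by (rule measurable_comp[OF Tn(1) T(1)])
  ultimately show ?case
    unfolding measure_preserving_def by blast
qed

lemma integral_measure_preserving:
  fixes f :: "'a \<Rightarrow> 'b::{banach, second_countable_topology}"
  assumes "measure_preserving M T" and "f \<in> borel_measurable M"
  shows "(\<integral>x. f (T x) \<partial>M) = (\<integral>x. f x \<partial>M)"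
  using integral_distr[OF measure_preservingD(1)[OF assms(1)] assms(2)]
    measure_preservingD(2)[OF assms(1)] by simp

lemma (in prob_space) integrable_bounded:
  fixes f :: "'a \<Rightarrow> 'b::{banach, second_countable_topology}"
  assumes "f \<in> borel_measurable M" and "\<And>x. x \<in> space M \<Longrightarrow> norm (f x) \<le> C"
  shows "integrable M f"
  using assms by (intro integrable_const_bound[of f C]) auto

lemma (in prob_space) norm_integral_bounded:
  fixes f :: "'a \<Rightarrow> 'b::{banach, second_countable_topology}"
  assumes "f \<in> borel_measurable M" and "\<And>x. x \<in> space M \<Longrightarrow> norm (f x) \<le> C"
  shows "norm (\<integral>x. f x \<partial>M) \<le> C"
proof -
  have "norm (\<integral>x. f x \<partial>M) \<le> (\<integral>x. norm (f x) \<partial>M)"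
    by (rule integral_norm_bound)
  also have "\<dots> \<le> (\<integral>x. C \<partial>M)"
    by (intro integral_mono integrable_norm integrable_bounded[OF assms] assms(2) integrable_const)
  finally show ?thesis
    by (simp add: prob_space)
qed

section \<open>Ergodicity and Birkhoff averages\<close>

definition ergodic :: "'a measure \<Rightarrow> ('a \<Rightarrow> 'a) \<Rightarrow> bool" where
  "ergodic M T \<longleftrightarrow> measure_preserving M T \<and>
     (\<forall>A\<in>sets M. T -` A \<inter> space M = A \<longrightarrow> measure M A = 0 \<or> measure M A = 1)"

text \<open>For an invariant set of measure m, every term of the weak mixing average with both sets
  equal to it is the same number |m - m^2|. The limit 0 therefore forces m = m^2.\<close>

lemma weakly_mixing_imp_ergodic:
  assumes "weakly_mixing M T"
  shows "ergodic M T"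
proof -
  have "measure M A = 0 \<or> measure M A = 1"
    if A: "A \<in> sets M" and inv: "T -` A \<inter> space M = A" for A
  proof -
    have T: "T \<in> M \<rightarrow>\<^sub>M M"
      using assms by (simp add: weakly_mixing_def measure_preserving_def)
    have "(T ^^ n) -` A \<inter> space M = A" for n
    proof (induction n)
      case 0
      then show ?case using sets.sets_into_space[OF A] by auto
    next
      case (Suc n)
      have "(T ^^ Suc n) -` A \<inter> space M = T -` ((T ^^ n) -` A \<inter> space M) \<inter> space M"
        using measurable_space[OF T] by (auto simp: funpow_swap1)
      then show ?case using Suc inv by metis
    qed
    then have "A \<inter> ((T ^^ n) -` A \<inter> space M) = A" for n
      by blast
    then have "(\<lambda>N. (1 / real N) * (\<Sum>n=1..N. \<bar>measure M A - measure M A * measure M A\<bar>)) \<longlonglongrightarrow> 0"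
      using assms A unfolding weakly_mixing_def by (elim conjE ballE[of _ _ A]) simp_all
    moreover have "(\<lambda>N. (1 / real N) * (\<Sum>n=1..N. \<bar>measure M A - measure M A * measure M A\<bar>))
        \<longlonglongrightarrow> \<bar>measure M A - measure M A * measure M A\<bar>"
      \<comment> \<open>The average over \<open>N = 0\<close> terms is 0, so the sequence is
        constant only for positive \<open>N\<close>.\<close>
      by (rule tendsto_eventually, rule eventually_mono[OF eventually_gt_at_top[of 0]]) simp
    ultimately have "\<bar>measure M A - measure M A * measure M A\<bar> = 0"
      using LIMSEQ_unique by blast
    then have "measure M A * (1 - measure M A) = 0"
      by (simp add: algebra_simps)
    then show ?thesis by simp
  qed
  then show ?thesis
    using assms by (auto simp: ergodic_def weakly_mixing_def)
qed

text \<open>Let \<open>F n\<close> be the maximum of the Birkhoff sums of \<open>f\<close> of lengths \<open>1, \<dots>, n + 1\<close>. The set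
  where \<open>F\<close> is unbounded is invariant. If it had full measure, then
  \<open>F (n+1) - F n \<circ> T = f - min 0 (F n \<circ> T)\<close> would converge to \<open>f\<close> boundedly almost
  everywhere, although its integral is nonnegative.\<close>

lemma (in prob_space) ergodic_sums_bounded_above:
  fixes f :: "'a \<Rightarrow> real"
  assumes erg: "ergodic M T" and [measurable]: "f \<in> borel_measurable M"
    and bd: "\<And>x. x \<in> space M \<Longrightarrow> \<bar>f x\<bar> \<le> C" and neg: "(\<integral>x. f x \<partial>M) < 0"
  shows "AE x in M. \<exists>B. \<forall>n. (\<Sum>i<n. f ((T ^^ i) x)) \<le> B"
proof -
  have mp: "measure_preserving M T"
    using erg by (simp add: ergodic_def)
  note T [measurable] = measure_preservingD(1)[OF mp]
  have Tsp: "T x \<in> space M" if "x \<in> space M" for x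
    using measurable_space[OF T that] .
  have C0: "C \<ge> 0"
    using bd not_empty by fastforce
  \<comment> \<open>A longer sum is \<open>f x\<close> plus a sum along the orbit of
    \<open>T x\<close>, and the 0 under \<open>max\<close> stands for the sum of length 1. The
    recursive form gives measurability and the difference formula directly.\<close>
  define F where "F = rec_nat f (\<lambda>_ G x. f x + max 0 (G (T x)))"
  have F0: "F 0 = f" and FS: "F (Suc n) = (\<lambda>x. f x + max 0 (F n (T x)))" for n
    by (auto simp: F_def)
  have Fm [measurable]: "F n \<in> borel_measurable M" for n
    by (induction n) (simp_all add: F0 FS)
  have Fmono: "F n x \<le> F (Suc n) x" for n x
  proof (induction n arbitrary: x)
    case (Suc n)
    then show ?case
      using Suc[of "T x"] by (simp add: FS[of n] FS[of "Suc n"] max.coboundedI2)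
  qed (simp add: F0 FS)
  have Flow: "- C \<le> F n x" if "x \<in> space M" for n x
    using bd[OF that] by (cases n) (auto simp: F0 FS)
  have Fup: "F n x \<le> (real n + 1) * C" if "x \<in> space M" for n x
    using that
  proof (induction n arbitrary: x)
    case 0
    then show ?case using bd[of x] by (simp add: F0)
  next
    case (Suc n)
    have "f x \<le> C" "F n (T x) \<le> (real n + 1) * C"
      using bd[OF Suc.prems] Suc.IH[OF Tsp[OF Suc.prems]] by auto
    moreover have "0 \<le> (real n + 1) * C"
      using C0 by simp
    moreover have "(real (Suc n) + 1) * C = C + (real n + 1) * C"
      by (simp add: algebra_simps)
    ultimately show ?case
      by (simp add: FS)
  qed
  have Fint: "integrable M (F n)" for n
  proof (rule integrable_bounded[OF Fm])
    fix x assume "x \<in> space M"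
    then show "norm (F n x) \<le> (real n + 1) * C"
      using Flow[of x n] Fup[of x n] C0 mult_right_mono[of 1 "real n + 1" C] by auto
  qed
  have FTint: "integrable M (\<lambda>x. F n (T x))" for n
    using Fint[of n] integrable_distr_eq[of T M M "F n"] measure_preservingD(2)[OF mp] by auto
  have sum_le: "(\<Sum>i<Suc n. f ((T ^^ i) x)) \<le> F n x" for n x
  proof (induction n arbitrary: x)
    case 0
    then show ?case by (simp add: F0)
  next
    case (Suc n)
    have "(\<Sum>i<Suc (Suc n). f ((T ^^ i) x)) = f x + (\<Sum>i<Suc n. f ((T ^^ i) (T x)))"
      by (subst sum.lessThan_Suc_shift) (simp del: sum.lessThan_Suc add: funpow_swap1)
    also have "\<dots> \<le> F (Suc n) x"
      using Suc[of "T x"] by (simp add: FS)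
    finally show ?case .
  qed
  \<comment> \<open>Natural thresholds keep the quantifiers countable, which gives measurability;
    \<open>E_iff\<close> passes to real thresholds.\<close>
  define E where "E = {x \<in> space M. \<forall>b::nat. \<exists>n. F n x > real b}"
  have [measurable]: "E \<in> sets M"
    unfolding E_def by measurable
  have E_iff: "x \<in> E \<longleftrightarrow> (\<forall>b. \<exists>n. F n x > b)" if "x \<in> space M" for x
  proof
    assume x: "x \<in> E"
    show "\<forall>b. \<exists>n. F n x > b"
    proof
      fix b :: real
      obtain m where "b < real m"
        using reals_Archimedean2 by blast
      moreover obtain n where "real m < F n x"
        using x by (auto simp: E_def)
      ultimately show "\<exists>n. F n x > b"
        by (auto intro: exI[of _ n])
    qed
  qed (use that in \<open>auto simp: E_def\<close>)
  have inv: "T x \<in> E \<longleftrightarrow> x \<in> E" if x: "x \<in> space M" for x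
  proof
    assume "T x \<in> E"
    then have a: "\<forall>b. \<exists>n. F n (T x) > b"
      using E_iff[OF Tsp[OF x]] by simp
    have "\<exists>n. F n x > b" for b
    proof -
      obtain n where "F n (T x) > b - f x" using a by blast
      then have "F (Suc n) x > b" by (simp add: FS)
      then show ?thesis ..
    qed
    then show "x \<in> E" using E_iff[OF x] by simp
  next
    assume "x \<in> E"
    then have a: "\<forall>b. \<exists>n. F n x > b"
      using E_iff[OF x] by simp
    have "\<exists>n. F n (T x) > b" for b
    proof -
      \<comment> \<open>The threshold \<open>max b 0\<close> makes the truncated maximum in
        \<open>F (Suc n) x\<close> positive, so it equals \<open>F n (T x)\<close>.\<close>
      obtain n where n: "F n x > max b 0 + f x" using a by blast
      then have "F (Suc n) x > max b 0 + f x" using Fmono[of n x] by linarith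
      then have "F n (T x) > b" by (auto simp: FS)
      then show ?thesis ..
    qed
    then show "T x \<in> E" using E_iff[OF Tsp[OF x]] by simp
  qed
  have "T -` E \<inter> space M = E"
    using inv by (auto simp: E_def)
  then have "measure M E = 0 \<or> measure M E = 1"
    using erg by (simp add: ergodic_def)
  moreover have "measure M E \<noteq> 1"
  proof
    assume "measure M E = 1"
    then have aeE: "AE x in M. x \<in> E"
      by (subst (asm) prob_eq_1) auto
    \<comment> \<open>On \<open>E\<close> some \<open>F n (T x)\<close> is positive, and by
      monotonicity the correction vanishes from then on. Since \<open>F n\<close> is at least
      \<open>- C\<close>, the integrands are dominated by \<open>2 * C\<close>.\<close>
    have "(\<lambda>n. \<integral>x. f x - min 0 (F n (T x)) \<partial>M) \<longlonglongrightarrow> (\<integral>x. f x \<partial>M)"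
    proof (rule integral_dominated_convergence[where w = "\<lambda>_. 2 * C"])
      show "AE x in M. (\<lambda>n. f x - min 0 (F n (T x))) \<longlonglongrightarrow> f x"
        using aeE
      proof eventually_elim
        case (elim x)
        then have x: "x \<in> space M" by (simp add: E_def)
        then obtain n where n: "F n (T x) > 0"
          using elim inv[OF x] E_iff[OF Tsp[OF x]] by blast
        have "f x - min 0 (F m (T x)) = f x" if "m \<ge> n" for m
          using n lift_Suc_mono_le[of "\<lambda>i. F i (T x)", OF Fmono that] by simp
        then show ?case
          by (intro tendsto_eventually eventually_sequentiallyI)
      qed
      show "AE x in M. norm (f x - min 0 (F n (T x))) \<le> 2 * C" for n
      proof (rule AE_I2)
        fix x assume x: "x \<in> space M"
        show "norm (f x - min 0 (F n (T x))) \<le> 2 * C"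
          using bd[OF x] Flow[OF Tsp[OF x], of n] by (auto simp: min_def)
      qed
    qed auto
    moreover have "(\<integral>x. f x - min 0 (F n (T x)) \<partial>M) \<ge> 0" for n
    proof -
      have "(\<integral>x. f x - min 0 (F n (T x)) \<partial>M) = (\<integral>x. F (Suc n) x - F n (T x) \<partial>M)"
        by (intro Bochner_Integration.integral_cong) (auto simp: FS)
      also have "\<dots> = (\<integral>x. F (Suc n) x \<partial>M) - (\<integral>x. F n x \<partial>M)"
        using Fint FTint integral_measure_preserving[OF mp Fm] by simp
      also have "\<dots> \<ge> 0"
        using integral_mono[OF Fint Fint Fmono] by simp
      finally show ?thesis .
    qed
    ultimately have "(\<integral>x. f x \<partial>M) \<ge> 0"
      by (intro LIMSEQ_le_const) auto
    then show False using neg by simp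
  qed
  ultimately have "AE x in M. x \<notin> E"
    using prob_eq_0[of E] by auto
  then show ?thesis
    using AE_space
  proof eventually_elim
    case (elim x)
    then obtain b where b: "\<And>n. F n x \<le> b"
      using E_iff by (meson not_le)
    \<comment> \<open>\<open>F (n - 1)\<close> controls the sum of length \<open>n\<close>; the 0
      covers the empty sum.\<close>
    have "(\<Sum>i<n. f ((T ^^ i) x)) \<le> max 0 b" for n
      using b[of "n - 1"] sum_le[of x "n - 1"] by (cases n) auto
    then show ?case by blast
  qed
qed

text \<open>Subtracting \<open>1 / Suc q\<close> from \<open>f\<close> makes the integral negative,
  so the sums of the difference are bounded above, and the sums of \<open>f\<close> exceed
  \<open>N / Suc q\<close> by at most a constant. Countably many \<open>q\<close> share one null
  set.\<close>

lemma (in prob_space) birkhoff_upper: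
  fixes f :: "'a \<Rightarrow> real"
  assumes erg: "ergodic M T" and [measurable]: "f \<in> borel_measurable M"
    and bd: "\<And>x. x \<in> space M \<Longrightarrow> \<bar>f x\<bar> \<le> C" and zero: "(\<integral>x. f x \<partial>M) = 0"
  shows "AE x in M. \<forall>e>0. \<forall>\<^sub>F N in sequentially. (\<Sum>i<N. f ((T ^^ i) x)) \<le> e * real N"
proof -
  have "AE x in M. \<exists>B. \<forall>N. (\<Sum>i<N. f ((T ^^ i) x) - 1 / Suc q) \<le> B" for q
  proof (rule ergodic_sums_bounded_above[OF erg])
    show "\<bar>f x - 1 / Suc q\<bar> \<le> C + 1" if "x \<in> space M" for x
    proof -
      have "0 \<le> 1 / real (Suc q)" "1 / real (Suc q) \<le> 1" by auto
      then show ?thesis using bd[OF that] by linarith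
    qed
    have "integrable M f"
      using bd by (intro integrable_bounded[of f C]) auto
    then show "(\<integral>x. f x - 1 / Suc q \<partial>M) < 0"
      using zero by (simp add: prob_space)
  qed auto
  then have "AE x in M. \<forall>q. \<exists>B. \<forall>N. (\<Sum>i<N. f ((T ^^ i) x) - 1 / Suc q) \<le> B"
    by (simp add: AE_all_countable)
  then show ?thesis
  proof (eventually_elim, intro allI impI)
    fix x and e :: real
    assume B: "\<forall>q. \<exists>B. \<forall>N. (\<Sum>i<N. f ((T ^^ i) x) - 1 / Suc q) \<le> B" and "e > 0"
    then obtain q where q: "1 / real (Suc q) < e / 2"
      using reals_Archimedean[of "e / 2"] by (auto simp: inverse_eq_divide)
    obtain b where b: "\<And>N. (\<Sum>i<N. f ((T ^^ i) x) - 1 / Suc q) \<le> b"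
      using B by blast
    \<comment> \<open>Beyond \<open>2 * b / e\<close> the constant \<open>b\<close> uses up at most
      half of \<open>e * N\<close>; the choice of \<open>q\<close> accounts for the other
      half.\<close>
    have "(\<Sum>i<N. f ((T ^^ i) x)) \<le> e * real N" if N: "N \<ge> nat \<lceil>2 * b / e\<rceil>" for N
    proof -
      have "2 * b / e \<le> real N" using N by linarith
      then have "b \<le> e / 2 * real N"
        using \<open>e > 0\<close> by (simp add: field_simps)
      moreover have "(\<Sum>i<N. f ((T ^^ i) x)) - real N * (1 / Suc q) \<le> b"
        using b[of N] by (simp add: sum_subtractf)
      moreover have "real N * (1 / Suc q) \<le> real N * (e / 2)"
        using q by (intro mult_left_mono) auto
      moreover have "e * real N = e / 2 * real N + real N * (e / 2)"
        by simp
      ultimately show ?thesis by linarith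
    qed
    then show "\<forall>\<^sub>F N in sequentially. (\<Sum>i<N. f ((T ^^ i) x)) \<le> e * real N"
      by (rule eventually_sequentiallyI)
  qed
qed

text \<open>The one-sided bound is applied to \<open>f\<close> and to \<open>- f\<close>.\<close>

lemma (in prob_space) birkhoff_real:
  fixes f :: "'a \<Rightarrow> real"
  assumes erg: "ergodic M T" and [measurable]: "f \<in> borel_measurable M"
    and bd: "\<And>x. x \<in> space M \<Longrightarrow> \<bar>f x\<bar> \<le> C" and zero: "(\<integral>x. f x \<partial>M) = 0"
  shows "AE x in M. (\<lambda>N. (\<Sum>i<N. f ((T ^^ i) x)) / real N) \<longlonglongrightarrow> 0"
proof -
  have "AE x in M. \<forall>e>0. \<forall>\<^sub>F N in sequentially. (\<Sum>i<N. f ((T ^^ i) x)) \<le> e * real N"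
    using birkhoff_upper[OF erg _ bd zero] by simp
  moreover have "AE x in M. \<forall>e>0. \<forall>\<^sub>F N in sequentially. (\<Sum>i<N. - f ((T ^^ i) x)) \<le> e * real N"
    using birkhoff_upper[OF erg, of "\<lambda>x. - f x" C] bd zero by simp
  ultimately show ?thesis
  proof eventually_elim
    case (elim x)
    show ?case
    proof (rule tendstoI)
      fix e :: real assume "e > 0"
      then have "e / 2 > 0" by simp
      then have "\<forall>\<^sub>F N in sequentially. (\<Sum>i<N. f ((T ^^ i) x)) \<le> e / 2 * real N"
        "\<forall>\<^sub>F N in sequentially. (\<Sum>i<N. - f ((T ^^ i) x)) \<le> e / 2 * real N"
        using elim by blast+
      then show "\<forall>\<^sub>F N in sequentially. dist ((\<Sum>i<N. f ((T ^^ i) x)) / real N) 0 < e"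
        using eventually_gt_at_top[of 0]
      proof eventually_elim
        case (elim N)
        then have "\<bar>\<Sum>i<N. f ((T ^^ i) x)\<bar> \<le> e / 2 * real N"
          by (simp add: sum_negf abs_le_iff)
        also have "\<dots> < e * real N"
          using \<open>e > 0\<close> elim by simp
        finally show ?case
          using elim by (simp add: dist_real_def field_simps)
      qed
    qed
  qed
qed

lemma (in prob_space) birkhoff:
  fixes f :: "'a \<Rightarrow> complex"
  assumes erg: "ergodic M T" and [measurable]: "f \<in> borel_measurable M"
    and bd: "\<And>x. x \<in> space M \<Longrightarrow> cmod (f x) \<le> C" and zero: "(\<integral>x. f x \<partial>M) = 0"
  shows "AE x in M. (\<lambda>N. (\<Sum>i<N. f ((T ^^ i) x)) / of_nat N) \<longlonglongrightarrow> 0"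
proof -
  have int: "integrable M f"
    using bd by (intro integrable_bounded[of f C]) auto
  have "AE x in M. (\<lambda>N. (\<Sum>i<N. Re (f ((T ^^ i) x))) / real N) \<longlonglongrightarrow> 0"
    using int zero bd
    by (intro birkhoff_real[OF erg, of _ C]) (auto intro: order_trans[OF abs_Re_le_cmod])
  moreover have "AE x in M. (\<lambda>N. (\<Sum>i<N. Im (f ((T ^^ i) x))) / real N) \<longlonglongrightarrow> 0"
    using int zero bd
    by (intro birkhoff_real[OF erg, of _ C]) (auto intro: order_trans[OF abs_Im_le_cmod])
  ultimately show ?thesis
  proof eventually_elim
    case (elim x)
    then show ?case
      by (subst tendsto_complex_iff) (simp add: Re_divide_of_nat Im_divide_of_nat)
  qed
qed

subsection \<open>Decay of correlations\<close>

definition bounded_measurable :: "'a measure \<Rightarrow> ('a \<Rightarrow> complex) \<Rightarrow> bool" where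
  "bounded_measurable M f \<longleftrightarrow> f \<in> borel_measurable M \<and> (\<exists>C. \<forall>x\<in>space M. cmod (f x) \<le> C)"

lemma bounded_measurableI:
  assumes "f \<in> borel_measurable M" and "\<And>x. x \<in> space M \<Longrightarrow> cmod (f x) \<le> C"
  shows "bounded_measurable M f"
  using assms unfolding bounded_measurable_def by blast

lemma bounded_measurableD:
  assumes "bounded_measurable M f"
  shows "f \<in> borel_measurable M" and "\<exists>C>0. \<forall>x\<in>space M. cmod (f x) \<le> C"
proof -
  obtain C where "\<forall>x\<in>space M. cmod (f x) \<le> C"
    using assms unfolding bounded_measurable_def by blast
  then show "\<exists>C>0. \<forall>x\<in>space M. cmod (f x) \<le> C"
    by (intro exI[of _ "\<bar>C\<bar> + 1"]) force
qed (use assms in \<open>simp add: bounded_measurable_def\<close>)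

lemma bounded_measurable_const: "bounded_measurable M (\<lambda>_. a)"
  by (rule bounded_measurableI[of _ _ "cmod a"]) auto

lemma bounded_measurable_indicator:
  assumes "A \<in> sets M"
  shows "bounded_measurable M (indicator A)"
  using assms by (intro bounded_measurableI[of _ _ 1]) (auto simp: indicator_def)

lemma bounded_measurable_mult:
  assumes "bounded_measurable M f" and "bounded_measurable M g"
  shows "bounded_measurable M (\<lambda>x. f x * g x)"
proof -
  note [measurable] = assms[THEN bounded_measurableD(1)]
  obtain C where "C > 0" "\<forall>x\<in>space M. cmod (f x) \<le> C"
    using bounded_measurableD(2)[OF assms(1)] by blast
  moreover obtain D where "D > 0" "\<forall>x\<in>space M. cmod (g x) \<le> D"
    using bounded_measurableD(2)[OF assms(2)] by blast
  ultimately show ?thesis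
    by (intro bounded_measurableI[of _ _ "C * D"]) (auto simp: norm_mult intro!: mult_mono)
qed

lemma bounded_measurable_add:
  assumes "bounded_measurable M f" and "bounded_measurable M g"
  shows "bounded_measurable M (\<lambda>x. f x + g x)"
proof -
  note [measurable] = assms[THEN bounded_measurableD(1)]
  obtain C where "\<forall>x\<in>space M. cmod (f x) \<le> C"
    using bounded_measurableD(2)[OF assms(1)] by blast
  moreover obtain D where "\<forall>x\<in>space M. cmod (g x) \<le> D"
    using bounded_measurableD(2)[OF assms(2)] by blast
  ultimately show ?thesis
    by (intro bounded_measurableI[of _ _ "C + D"]) (auto intro!: norm_triangle_mono)
qed

lemma bounded_measurable_diff:
  assumes "bounded_measurable M f" and "bounded_measurable M g"
  shows "bounded_measurable M (\<lambda>x. f x - g x)"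
  using bounded_measurable_add[OF assms(1) bounded_measurable_mult[OF bounded_measurable_const[of _ "-1"] assms(2)]]
  by simp

lemma bounded_measurable_cnj:
  assumes "bounded_measurable M f"
  shows "bounded_measurable M (\<lambda>x. cnj (f x))"
proof -
  obtain C where C: "\<forall>x\<in>space M. cmod (f x) \<le> C"
    using bounded_measurableD(2)[OF assms] by blast
  have "cnj \<in> borel_measurable borel"
    by (intro borel_measurable_continuous_onI continuous_intros)
  with bounded_measurableD(1)[OF assms] have "(\<lambda>x. cnj (f x)) \<in> borel_measurable M"
    by (rule measurable_compose)
  then show ?thesis
    using C by (intro bounded_measurableI[of _ _ C]) auto
qed

lemma bounded_measurable_compose:
  assumes "bounded_measurable M f" and "T \<in> M \<rightarrow>\<^sub>M M"
  shows "bounded_measurable M (\<lambda>x. f (T x))"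
proof -
  obtain C where "\<forall>x\<in>space M. cmod (f x) \<le> C"
    using bounded_measurableD(2)[OF assms(1)] by blast
  then show ?thesis
    using measurable_space[OF assms(2)] measurable_compose[OF assms(2) bounded_measurableD(1)[OF assms(1)]]
    by (intro bounded_measurableI[of _ _ C]) auto
qed

lemma (in prob_space) integrable_bounded_measurable:
  assumes "bounded_measurable M f"
  shows "integrable M f"
  using bounded_measurableD[OF assms] integrable_bounded[of f] by blast

text \<open>Rounding a bounded function to a grid leaves finitely many values, hence a linear
  combination of indicators. The approximation is uniform on \<open>space M\<close>, so it yields
  estimates that do not depend on the power of the transformation.\<close>

lemma bounded_measurable_induct [consumes 1, case_names indicator scale add approx]:
  assumes f: "bounded_measurable M f"
    and ind: "\<And>A. A \<in> sets M \<Longrightarrow> P (indicator A)"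
    and scale: "\<And>a f. bounded_measurable M f \<Longrightarrow> P f \<Longrightarrow> P (\<lambda>x. a * f x)"
    and add: "\<And>f g. bounded_measurable M f \<Longrightarrow> bounded_measurable M g \<Longrightarrow> P f \<Longrightarrow> P g \<Longrightarrow> P (\<lambda>x. f x + g x)"
    and approx: "\<And>f. bounded_measurable M f \<Longrightarrow>
      (\<And>e. e > 0 \<Longrightarrow> \<exists>g. bounded_measurable M g \<and> P g \<and> (\<forall>x\<in>space M. cmod (f x - g x) \<le> e)) \<Longrightarrow> P f"
  shows "P f"
proof (rule approx[OF f])
  fix e :: real assume "e > 0"
  \<comment> \<open>The real and the imaginary part each contribute a rounding error of at most
    \<open>d\<close>.\<close>
  define d where "d = e / 2"
  have d: "d > 0" using \<open>e > 0\<close> by (simp add: d_def)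
  note [measurable] = bounded_measurableD(1)[OF f]
  obtain C where C: "\<forall>x\<in>space M. cmod (f x) \<le> C"
    using bounded_measurableD(2)[OF f] by blast
  define q where "q x = Complex (d * of_int \<lfloor>Re (f x) / d\<rfloor>) (d * of_int \<lfloor>Im (f x) / d\<rfloor>)" for x
  have qm [measurable]: "q \<in> borel_measurable M"
    unfolding q_def Complex_eq by measurable
  have round: "\<bar>t - d * of_int \<lfloor>t / d\<rfloor>\<bar> \<le> d" for t :: real
  proof -
    have "d * of_int \<lfloor>t / d\<rfloor> \<le> d * (t / d)" "d * (t / d) \<le> d * (of_int \<lfloor>t / d\<rfloor> + 1)"
      using d by (intro mult_left_mono; linarith)+
    moreover have "d * (t / d) = t"
      using d by simp
    ultimately show ?thesis
      unfolding distrib_left by linarith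
  qed
  have dist: "cmod (f x - q x) \<le> e" for x
    using cmod_le[of "f x - q x"] round[of "Re (f x)"] round[of "Im (f x)"]
    by (simp add: q_def d_def)
  \<comment> \<open>A bound for the integer coordinates of all rounded values; the extra 1 allows
    for rounding down a negative number.\<close>
  define L where "L = \<lceil>C / d\<rceil> + 1"
  have L: "\<lfloor>t / d\<rfloor> \<in> {-L..L}" if "\<bar>t\<bar> \<le> C" for t
  proof -
    have "- (C / d) \<le> t / d" "t / d \<le> C / d"
      unfolding minus_divide_left using that d by (intro divide_right_mono; linarith)+
    then show ?thesis
      unfolding L_def atLeastAtMost_iff by linarith
  qed
  have "q ` space M \<subseteq> (\<lambda>(i, j). Complex (d * of_int i) (d * of_int j)) ` ({-L..L} \<times> {-L..L})"
  proof
    fix v assume "v \<in> q ` space M"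
    then obtain x where x: "x \<in> space M" "v = q x" by blast
    have "\<lfloor>Re (f x) / d\<rfloor> \<in> {-L..L}" "\<lfloor>Im (f x) / d\<rfloor> \<in> {-L..L}"
      using bspec[OF C x(1)] abs_Re_le_cmod[of "f x"] abs_Im_le_cmod[of "f x"] by (intro L; linarith)+
    then show "v \<in> (\<lambda>(i, j). Complex (d * of_int i) (d * of_int j)) ` ({-L..L} \<times> {-L..L})"
      unfolding x(2) q_def by (intro image_eqI[of _ _ "(\<lfloor>Re (f x) / d\<rfloor>, \<lfloor>Im (f x) / d\<rfloor>)"]) auto
  qed
  then have fin: "finite (q ` space M)"
    by (rule finite_subset) auto
  have A: "q -` {v} \<inter> space M \<in> sets M" for v
    by measurable
  have sums: "bounded_measurable M (\<lambda>x. \<Sum>v\<in>V. v * indicator (q -` {v} \<inter> space M) x) \<and>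
    P (\<lambda>x. \<Sum>v\<in>V. v * indicator (q -` {v} \<inter> space M) x)" if "finite V" for V
    using that
  proof induction
    case empty
    then show ?case
      using scale[of "indicator {}" 0] bounded_measurable_indicator[of "{}" M] ind[of "{}"]
        bounded_measurable_const[of M 0] by simp
  next
    case (insert v V)
    have "bounded_measurable M (\<lambda>x. v * indicator (q -` {v} \<inter> space M) x)"
      "P (\<lambda>x. v * indicator (q -` {v} \<inter> space M) x)"
      using bounded_measurable_mult[OF bounded_measurable_const bounded_measurable_indicator[OF A]]
        scale[OF bounded_measurable_indicator[OF A] ind[OF A]] by blast+
    then show ?case
      unfolding sum.insert[OF insert.hyps] using insert.IH add bounded_measurable_add by blast
  qed
  have eq: "(\<Sum>v\<in>q ` space M. v * indicator (q -` {v} \<inter> space M) x) = q x" if "x \<in> space M" for x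
  proof -
    have "(\<Sum>v\<in>q ` space M. v * indicator (q -` {v} \<inter> space M) x)
        = (\<Sum>v\<in>q ` space M. if v = q x then q x else 0)"
      using that by (intro sum.cong) (auto simp: indicator_def)
    then show ?thesis using fin that by simp
  qed
  show "\<exists>g. bounded_measurable M g \<and> P g \<and> (\<forall>x\<in>space M. cmod (f x - g x) \<le> e)"
  proof (intro exI conjI ballI)
    fix x assume "x \<in> space M"
    show "cmod (f x - (\<Sum>v\<in>q ` space M. v * indicator (q -` {v} \<inter> space M) x)) \<le> e"
      unfolding eq[OF \<open>x \<in> space M\<close>] by (rule dist)
  qed (use sums[OF fin] in blast)+
qed

section \<open>Sequences with vanishing Cesaro averages\<close>

definition cesaro_null :: "(nat \<Rightarrow> real) \<Rightarrow> bool" where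
  "cesaro_null d \<longleftrightarrow> (\<lambda>N. (1 / real N) * (\<Sum>n=1..N. d n)) \<longlonglongrightarrow> 0"

lemma cesaro_null_mult:
  assumes "cesaro_null d"
  shows "cesaro_null (\<lambda>n. a * d n)"
  using tendsto_mult_left[OF assms[unfolded cesaro_null_def], of a]
  by (simp add: cesaro_null_def sum_distrib_left mult_ac)

lemma cesaro_null_add:
  assumes "cesaro_null d" and "cesaro_null d'"
  shows "cesaro_null (\<lambda>n. d n + d' n)"
  using tendsto_add[OF assms[unfolded cesaro_null_def]]
  by (simp add: cesaro_null_def sum.distrib distrib_left)

text \<open>Averaging preserves the inequality, so the averages of \<open>d\<close> are eventually
  below any positive number. The comparison sequence may change with \<open>e\<close>.\<close>

lemma cesaro_null_approx:
  assumes nonneg: "\<And>n. d n \<ge> 0"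
    and approx: "\<And>e. e > 0 \<Longrightarrow> \<exists>d'. cesaro_null d' \<and> (\<forall>n. d n \<le> d' n + e)"
  shows "cesaro_null d"
  unfolding cesaro_null_def
proof (rule tendstoI)
  fix e :: real assume "e > 0"
  then obtain d' where d': "cesaro_null d'" "\<And>n. d n \<le> d' n + e / 2"
    using approx[of "e / 2"] by auto
  have "\<forall>\<^sub>F N in sequentially. (1 / real N) * (\<Sum>n=1..N. d' n) < e / 2"
    using d'(1) \<open>e > 0\<close> unfolding cesaro_null_def by (intro order_tendstoD(2)[of _ 0]) auto
  then show "\<forall>\<^sub>F N in sequentially. dist ((1 / real N) * (\<Sum>n=1..N. d n)) 0 < e"
    using eventually_gt_at_top[of 0]
  proof eventually_elim
    case (elim N)
    have "(\<Sum>n=1..N. d n) \<le> (\<Sum>n=1..N. d' n + e / 2)"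
      using d'(2) by (intro sum_mono) auto
    also have "\<dots> = (\<Sum>n=1..N. d' n) + real N * (e / 2)"
      by (simp add: sum.distrib)
    finally have "(1 / real N) * (\<Sum>n=1..N. d n) \<le> (1 / real N) * ((\<Sum>n=1..N. d' n) + real N * (e / 2))"
      by (intro mult_left_mono) auto
    also have "\<dots> = (1 / real N) * (\<Sum>n=1..N. d' n) + e / 2"
      using elim by (simp add: field_simps)
    also have "\<dots> < e"
      using elim(1) by linarith
    finally show ?case
      using nonneg by (simp add: sum_nonneg dist_real_def)
  qed
qed

lemma cesaro_null_le:
  assumes "\<And>n. d n \<ge> 0" and "cesaro_null d'" and "\<And>n. d n \<le> d' n"
  shows "cesaro_null d"
proof (rule cesaro_null_approx[OF assms(1)])
  fix e :: real assume "e > 0"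
  then have "d n \<le> d' n + e" for n
    using assms(3)[of n] by linarith
  then show "\<exists>d'. cesaro_null d' \<and> (\<forall>n. d n \<le> d' n + e)"
    using assms(2) by blast
qed

section \<open>Correlations under a weakly mixing map\<close>

definition corr :: "'a measure \<Rightarrow> ('a \<Rightarrow> 'a) \<Rightarrow> ('a \<Rightarrow> complex) \<Rightarrow> ('a \<Rightarrow> complex) \<Rightarrow> nat \<Rightarrow> complex" where
  "corr M T f g n = (\<integral>x. f x * g ((T ^^ n) x) \<partial>M) - (\<integral>x. f x \<partial>M) * (\<integral>x. g x \<partial>M)"

context prob_space
begin

lemma corr_scale:
  shows "corr M T (\<lambda>x. a * f x) g n = a * corr M T f g n"
    and "corr M T f (\<lambda>x. a * g x) n = a * corr M T f g n"
proof -
  have "(\<integral>x. f x * (a * g ((T ^^ n) x)) \<partial>M) = (\<integral>x. a * (f x * g ((T ^^ n) x)) \<partial>M)"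
    by (simp add: mult_ac)
  then show "corr M T f (\<lambda>x. a * g x) n = a * corr M T f g n"
    by (simp add: corr_def algebra_simps)
qed (simp add: corr_def algebra_simps)

lemma corr_add:
  assumes T: "measure_preserving M T" and f: "bounded_measurable M f"
    and g: "bounded_measurable M g" and h: "bounded_measurable M h"
  shows "corr M T (\<lambda>x. f x + g x) h n = corr M T f h n + corr M T g h n"
    and "corr M T h (\<lambda>x. f x + g x) n = corr M T h f n + corr M T h g n"
proof -
  note [simp] = integrable_bounded_measurable bounded_measurable_mult assms
    bounded_measurable_compose[OF _ measure_preservingD(1)[OF measure_preserving_funpow[OF T]]]
  show "corr M T (\<lambda>x. f x + g x) h n = corr M T f h n + corr M T g h n"
    by (simp add: corr_def distrib_right)
  show "corr M T h (\<lambda>x. f x + g x) n = corr M T h f n + corr M T h g n"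
    by (simp add: corr_def distrib_left)
qed

text \<open>The bound does not depend on \<open>n\<close>: replacing one argument by a uniform
  approximation changes all correlations by a small amount at once.\<close>

lemma corr_bound:
  assumes T: "measure_preserving M T" and f: "bounded_measurable M f" and g: "bounded_measurable M g"
    and C: "\<And>x. x \<in> space M \<Longrightarrow> cmod (f x) \<le> C" and D: "\<And>x. x \<in> space M \<Longrightarrow> cmod (g x) \<le> D"
  shows "cmod (corr M T f g n) \<le> 2 * C * D"
proof -
  note Tn = measure_preservingD(1)[OF measure_preserving_funpow[OF T], of n]
  have C0: "C \<ge> 0"
    using not_empty C norm_ge_zero order_trans by (metis ex_in_conv)
  have "cmod (\<integral>x. f x * g ((T ^^ n) x) \<partial>M) \<le> C * D"
    using C D C0 measurable_space[OF Tn]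
    by (intro norm_integral_bounded bounded_measurableD(1) bounded_measurable_mult bounded_measurable_compose[OF _ Tn] f g)
      (auto simp: norm_mult intro!: mult_mono)
  moreover have "cmod ((\<integral>x. f x \<partial>M) * (\<integral>x. g x \<partial>M)) \<le> C * D"
    unfolding norm_mult by (intro mult_mono norm_integral_bounded bounded_measurableD(1) f g C D C0 norm_ge_zero)
  ultimately show ?thesis
    unfolding corr_def
    using norm_triangle_ineq4[of "\<integral>x. f x * g ((T ^^ n) x) \<partial>M" "(\<integral>x. f x \<partial>M) * (\<integral>x. g x \<partial>M)"]
    by linarith
qed

text \<open>For indicators the integrals are measures, and the correlation is the difference in the
  definition of weak mixing.\<close>

lemma corr_cesaro_null_indicator:
  assumes T: "weakly_mixing M T" and A: "A \<in> sets M" and B: "B \<in> sets M"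
  shows "cesaro_null (\<lambda>n. cmod (corr M T (indicator A) (indicator B) n))"
proof -
  have mp: "measure_preserving M T"
    using T by (simp add: weakly_mixing_def)
  have "cmod (corr M T (indicator A) (indicator B) n) =
      \<bar>measure M (A \<inter> ((T ^^ n) -` B \<inter> space M)) - measure M A * measure M B\<bar>" for n
  proof -
    have "(T ^^ n) -` B \<inter> space M \<in> sets M"
      using measure_preservingD(1)[OF measure_preserving_funpow[OF mp]] B by (rule measurable_sets)
    then have E: "A \<inter> ((T ^^ n) -` B \<inter> space M) \<in> sets M"
      using A by blast
    have I: "(\<integral>x. (indicator S x :: complex) \<partial>M) = of_real (measure M S)" if "S \<in> sets M" for S
    proof -
      have "(indicator S :: 'a \<Rightarrow> complex) = (\<lambda>x. of_real (indicator S x))"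
        by (auto simp: indicator_def)
      then show ?thesis
        using sets.Int_space_eq2[OF that] by simp
    qed
    have "(\<integral>x. (indicator A x :: complex) * indicator B ((T ^^ n) x) \<partial>M)
        = (\<integral>x. indicator (A \<inter> ((T ^^ n) -` B \<inter> space M)) x \<partial>M)"
      by (intro Bochner_Integration.integral_cong) (auto simp: indicator_def)
    then have "corr M T (indicator A) (indicator B) n =
        of_real (measure M (A \<inter> ((T ^^ n) -` B \<inter> space M)) - measure M A * measure M B)"
      using I[OF A] I[OF B] I[OF E] by (simp add: corr_def)
    then show ?thesis
      by (simp only: norm_of_real)
  qed
  then show ?thesis
    using T A B by (simp add: weakly_mixing_def cesaro_null_def)
qed

text \<open>\<open>corr\<close> has no conjugation and is linear in each argument, so the indicator
  case extends by \<open>bounded_measurable_induct\<close>, first in \<open>f\<close> against a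
  fixed indicator and then in \<open>g\<close> against a fixed \<open>f\<close>.\<close>

lemma corr_cesaro_null:
  assumes T: "weakly_mixing M T" and f: "bounded_measurable M f" and g: "bounded_measurable M g"
  shows "cesaro_null (\<lambda>n. cmod (corr M T f g n))"
proof -
  have mp: "measure_preserving M T"
    using T by (simp add: weakly_mixing_def)
  \<comment> \<open>This adapts \<open>cesaro_null_approx\<close> to errors of the size given by
    \<open>corr_bound\<close>; the factor \<open>2 * D\<close> is absorbed into
    \<open>e\<close>.\<close>
  have uniform: "cesaro_null d"
    if "\<And>n. d n \<ge> 0" "D > 0" "\<And>e. e > 0 \<Longrightarrow> \<exists>d'. cesaro_null d' \<and> (\<forall>n. d n \<le> d' n + 2 * e * D)" for d D
  proof (rule cesaro_null_approx[OF that(1)])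
    fix e :: real assume "e > 0"
    then show "\<exists>d'. cesaro_null d' \<and> (\<forall>n. d n \<le> d' n + e)"
      using that(3)[of "e / (2 * D)"] \<open>D > 0\<close> by simp
  qed
  have f_ind: "cesaro_null (\<lambda>n. cmod (corr M T f (indicator B) n))" if B: "B \<in> sets M" for B
    using f
  proof (induction rule: bounded_measurable_induct)
    case (indicator A)
    then show ?case using corr_cesaro_null_indicator[OF T _ B] by blast
  next
    case (scale a f)
    then show ?case using cesaro_null_mult[of _ "cmod a"] by (simp add: corr_scale norm_mult)
  next
    case (add f g)
    show ?case
      by (rule cesaro_null_le[OF _ cesaro_null_add[OF add(3,4)]])
        (auto simp: corr_add[OF mp add(1,2) bounded_measurable_indicator[OF B]] norm_triangle_ineq)
  next
    case (approx f)
    note B' = bounded_measurable_indicator[OF B]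
    show ?case
    proof (rule uniform[of _ 1])
      fix e :: real assume "e > 0"
      then obtain g where g: "bounded_measurable M g" "cesaro_null (\<lambda>n. cmod (corr M T g (indicator B) n))"
        "\<forall>x\<in>space M. cmod (f x - g x) \<le> e"
        using approx(2) by blast
      have fg: "bounded_measurable M (\<lambda>x. f x - g x)"
        using approx(1) g(1) by (rule bounded_measurable_diff)
      have "cmod (corr M T f (indicator B) n) \<le> cmod (corr M T g (indicator B) n) + 2 * e * 1" for n
      proof -
        have "corr M T f (indicator B) n = corr M T g (indicator B) n + corr M T (\<lambda>x. f x - g x) (indicator B) n"
          using corr_add(1)[OF mp g(1) fg B', of n] by simp
        also have "cmod \<dots> \<le> cmod (corr M T g (indicator B) n) + 2 * e * 1"
          by (intro order_trans[OF norm_triangle_ineq] add_left_mono corr_bound[OF mp fg B'])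
            (use g(3) in \<open>auto simp: indicator_def\<close>)
        finally show ?thesis .
      qed
      then show "\<exists>d'. cesaro_null d' \<and> (\<forall>n. cmod (corr M T f (indicator B) n) \<le> d' n + 2 * e * 1)"
        using g(2) by blast
    qed auto
  qed
  show ?thesis
    using g
  proof (induction rule: bounded_measurable_induct)
    case (indicator A)
    then show ?case by (rule f_ind)
  next
    case (scale a g)
    then show ?case using cesaro_null_mult[of _ "cmod a"] by (simp add: corr_scale norm_mult)
  next
    case (add g h)
    show ?case
      by (rule cesaro_null_le[OF _ cesaro_null_add[OF add(3,4)]])
        (auto simp: corr_add[OF mp add(1,2) f] norm_triangle_ineq)
  next
    case (approx g)
    obtain D where D: "D > 0" "\<forall>x\<in>space M. cmod (f x) \<le> D"
      using bounded_measurableD(2)[OF f] by blast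
    show ?case
    proof (rule uniform[of _ D])
      fix e :: real assume "e > 0"
      then obtain h where h: "bounded_measurable M h" "cesaro_null (\<lambda>n. cmod (corr M T f h n))"
        "\<forall>x\<in>space M. cmod (g x - h x) \<le> e"
        using approx(2) by blast
      have gh: "bounded_measurable M (\<lambda>x. g x - h x)"
        using approx(1) h(1) by (rule bounded_measurable_diff)
      have "cmod (corr M T f g n) \<le> cmod (corr M T f h n) + 2 * e * D" for n
      proof -
        have "corr M T f g n = corr M T f h n + corr M T f (\<lambda>x. g x - h x) n"
          using corr_add(2)[OF mp h(1) gh f, of n] by simp
        also have "cmod \<dots> \<le> cmod (corr M T f h n) + 2 * D * e"
          by (intro order_trans[OF norm_triangle_ineq] add_left_mono corr_bound[OF mp f gh])
            (use h(3) D in auto)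
        finally show ?thesis by (simp add: mult_ac)
      qed
      then show "\<exists>d'. cesaro_null d' \<and> (\<forall>n. cmod (corr M T f g n) \<le> d' n + 2 * e * D)"
        using h(2) by blast
    qed (use D in auto)
  qed
qed

end

subsection \<open>Uniformity along cubes\<close>

text \<open>The conditions range over all functions, not only over points of the cube, so
  coordinates outside \<open>J\<close> can act as parameters and be frozen at any value.\<close>

definition cube_weights :: "nat set \<Rightarrow> (nat \<Rightarrow> (nat \<Rightarrow> nat) \<Rightarrow> complex) \<Rightarrow> bool" where
  "cube_weights J b \<longleftrightarrow> (\<forall>i\<in>J. \<forall>n. cmod (b i n) \<le> 1 \<and> (\<forall>v. b i (n(i := v)) = b i n))"

text \<open>The shift \<open>m\<close> absorbs the additional variable in the induction on the dimension.\<close>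

definition cube_uniform :: "nat set \<Rightarrow> (nat \<Rightarrow> complex) \<Rightarrow> bool" where
  "cube_uniform J c \<longleftrightarrow> (\<forall>K. \<forall>\<delta>>0. \<forall>\<^sub>F N in sequentially. \<forall>m\<le>K * N. \<forall>b. cube_weights J b \<longrightarrow>
     cmod (\<Sum>n\<in>J \<rightarrow>\<^sub>E {1..N}. c (m + (\<Sum>i\<in>J. n i)) * (\<Prod>i\<in>J. b i n)) \<le> \<delta> * real N ^ card J)"

lemma sum_PiE_insert:
  assumes "i \<notin> J"
  shows "(\<Sum>n\<in>insert i J \<rightarrow>\<^sub>E A. F n) = (\<Sum>v\<in>A. \<Sum>n\<in>J \<rightarrow>\<^sub>E A. F (n(i := v)))"
  unfolding PiE_insert_eq sum.reindex[OF inj_combinator[OF assms, of "\<lambda>_. A"]] sum.cartesian_product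
  by (simp add: case_prod_unfold)

lemma norm_prod_weights_le_1:
  assumes "cube_weights J b"
  shows "cmod (\<Prod>i\<in>J. b i n) \<le> 1"
  using assms unfolding cube_weights_def prod_norm[symmetric] by (intro prod_le_1) auto

text \<open>A weight independent of the only variable is a constant, and a sum over a window is a
  difference of two partial sums of \<open>c\<close>. These are small compared with their lengths,
  which are at most a multiple of \<open>N\<close> because \<open>m\<close> is.\<close>

lemma cube_uniform_singleton:
  assumes lim: "(\<lambda>N. (\<Sum>i<N. c i) / of_nat N) \<longlonglongrightarrow> 0"
  shows "cube_uniform {j} c"
  unfolding cube_uniform_def
proof (intro allI impI)
  fix K :: nat and \<delta> :: real assume "\<delta> > 0"
  define S where "S l = (\<Sum>i<l. c i)" for l
  \<comment> \<open>The two partial sums have total length \<open>2 * m + N + 2\<close>, at most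
    \<open>(2 * K + 3) * N\<close> when \<open>N\<close> is positive.\<close>
  define \<eta> where "\<eta> = \<delta> / (2 * (2 * real K + 3))"
  have \<eta>: "\<eta> > 0" "\<eta> * (2 * real K + 3) = \<delta> / 2"
    using \<open>\<delta> > 0\<close> by (simp_all add: \<eta>_def field_simps)
  have "\<forall>\<^sub>F N in sequentially. cmod (S N / of_nat N) < \<eta>"
    using tendstoD[OF lim \<eta>(1)] by (simp add: S_def dist_norm)
  then obtain L where L: "\<And>l. l \<ge> L \<Longrightarrow> cmod (S l / of_nat l) < \<eta>"
    unfolding eventually_sequentially by blast
  \<comment> \<open>\<open>B\<close> absorbs the finitely many short sums, so that the bound
    \<open>SB\<close> holds for every length.\<close>
  define B where "B = (\<Sum>l<L. cmod (S l))"
  have SB: "cmod (S l) \<le> \<eta> * real l + B" for l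
  proof (cases "l < L")
    case True
    then have "cmod (S l) \<le> B"
      unfolding B_def by (intro member_le_sum) auto
    then show ?thesis using \<eta>(1) by (simp add: add_increasing)
  next
    case False
    have "cmod (S l) \<le> \<eta> * real l"
    proof (cases "l = 0")
      case True
      then show ?thesis by (simp add: S_def)
    next
      case False
      then show ?thesis
        using L[of l] \<open>\<not> l < L\<close> by (simp add: norm_divide field_simps)
    qed
    moreover have "B \<ge> 0"
      unfolding B_def by (intro sum_nonneg) auto
    ultimately show ?thesis by linarith
  qed
  have bound: "cmod (\<Sum>n\<in>{j} \<rightarrow>\<^sub>E {1..N}. c (m + (\<Sum>i\<in>{j}. n i)) * (\<Prod>i\<in>{j}. b i n)) \<le> \<delta> * real N ^ card {j}"
    if N: "N \<ge> max 1 (nat \<lceil>4 * B / \<delta>\<rceil>)" and m: "m \<le> K * N" and b: "cube_weights {j} b" for N m b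
  proof -
    have B: "2 * B \<le> \<delta> / 2 * real N"
    proof -
      have "4 * B / \<delta> \<le> real N" using N by linarith
      then show ?thesis using \<open>\<delta> > 0\<close> by (simp add: field_simps)
    qed
    \<comment> \<open>Points of the one-dimensional cube are updates of
      \<open>\<lambda>_. undefined\<close> at \<open>j\<close>, and the weight ignores the
      update.\<close>
    have "(\<Sum>n\<in>{j} \<rightarrow>\<^sub>E {1..N}. c (m + (\<Sum>i\<in>{j}. n i)) * (\<Prod>i\<in>{j}. b i n))
        = (\<Sum>v\<in>{1..N}. c (m + v)) * b j (\<lambda>_. undefined)"
      using b by (simp add: sum_PiE_insert cube_weights_def sum_distrib_right)
    also have "(\<Sum>v\<in>{1..N}. c (m + v)) = S (m + N + 1) - S (m + 1)"
      by (induction N) (simp_all add: S_def)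
    finally have "cmod (\<Sum>n\<in>{j} \<rightarrow>\<^sub>E {1..N}. c (m + (\<Sum>i\<in>{j}. n i)) * (\<Prod>i\<in>{j}. b i n))
        = cmod (S (m + N + 1) - S (m + 1)) * cmod (b j (\<lambda>_. undefined))"
      by (simp add: norm_mult)
    also have "\<dots> \<le> cmod (S (m + N + 1) - S (m + 1))"
      using b by (intro mult_right_le_one_le) (auto simp: cube_weights_def)
    also have "\<dots> \<le> cmod (S (m + N + 1)) + cmod (S (m + 1))"
      by (rule norm_triangle_ineq4)
    also have "\<dots> \<le> (\<eta> * real (m + N + 1) + B) + (\<eta> * real (m + 1) + B)"
      by (intro add_mono SB)
    also have "\<dots> = \<eta> * (2 * real m + real N + 2) + 2 * B"
      by (simp add: algebra_simps)
    also have "\<dots> \<le> \<eta> * ((2 * real K + 3) * real N) + 2 * B"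
    proof -
      have "real m \<le> real K * real N" "1 \<le> real N"
        using m N by (simp_all flip: of_nat_mult)
      then have "2 * real m + real N + 2 \<le> (2 * real K + 3) * real N"
        by (simp add: algebra_simps)
      then show ?thesis using \<eta>(1) by simp
    qed
    also have "\<dots> = \<delta> / 2 * real N + 2 * B"
      by (simp only: mult.assoc[symmetric] \<eta>(2))
    also have "\<dots> \<le> \<delta> * real N"
      using B by (simp add: field_simps)
    finally show ?thesis by simp
  qed
  then show "\<forall>\<^sub>F N in sequentially. \<forall>m\<le>K * N. \<forall>b. cube_weights {j} b \<longrightarrow>
      cmod (\<Sum>n\<in>{j} \<rightarrow>\<^sub>E {1..N}. c (m + (\<Sum>i\<in>{j}. n i)) * (\<Prod>i\<in>{j}. b i n)) \<le> \<delta> * real N ^ card {j}"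
    by (intro eventually_sequentiallyI[of "max 1 (nat \<lceil>4 * B / \<delta>\<rceil>)"]) blast
qed

text \<open>Each shift by one replaces a single boundary term by another, at a cost of at most
  \<open>2 * C\<close>.\<close>

lemma norm_sum_shift_le:
  fixes u :: "nat \<Rightarrow> complex"
  assumes "\<And>v. cmod (u v) \<le> C"
  shows "cmod ((\<Sum>v=1..N. u v) - (\<Sum>v=1..N. u (v + r))) \<le> 2 * C * real r"
proof (induction r)
  case (Suc r)
  have step: "(\<Sum>v=1..N. u (v + r)) - (\<Sum>v=1..N. u (v + Suc r)) = u (1 + r) - u (N + 1 + r)"
    by (induction N) (simp_all add: algebra_simps)
  have "cmod ((\<Sum>v=1..N. u v) - (\<Sum>v=1..N. u (v + Suc r)))
      = cmod (((\<Sum>v=1..N. u v) - (\<Sum>v=1..N. u (v + r))) + (u (1 + r) - u (N + 1 + r)))"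
    by (simp only: step[symmetric]) simp
  also have "\<dots> \<le> 2 * C * real r + (C + C)"
    by (intro norm_triangle_mono Suc order_trans[OF norm_triangle_ineq4] add_mono assms)
  finally show ?case
    by (simp add: algebra_simps)
qed simp

text \<open>Van der Corput's inequality in the new variable \<open>n j\<close>: the weight that does not depend on it
  is removed by the Cauchy--Schwarz inequality, and the remaining weights combine with their shifts
  to weights for the smaller cube.\<close>

lemma cube_uniform_insert:
  fixes c :: "nat \<Rightarrow> complex" and \<rho> :: "nat \<Rightarrow> nat \<Rightarrow> complex"
  assumes J: "finite J" "j \<notin> J" and bd: "\<And>n. cmod (c n) \<le> C"
    and corr: "\<And>r s. cube_uniform J (\<lambda>l. c (l + r) * cnj (c (l + s)) - \<rho> r s)"
    and null: "(\<lambda>H. (\<Sum>r<H. \<Sum>s<H. cmod (\<rho> r s)) / (real H)\<^sup>2) \<longlonglongrightarrow> 0"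
  shows "cube_uniform (insert j J) c"
  unfolding cube_uniform_def
proof (intro allI impI)
  fix K :: nat and \<delta> :: real assume "\<delta> > 0"
  \<comment> \<open>The final bound for the squared norm of \<open>Y\<close> contains
    \<open>2 * \<eta>\<close>, which becomes the square of \<open>\<delta> / 2\<close>. The other
    half of \<delta> pays for the boundary terms.\<close>
  define \<eta> where "\<eta> = \<delta>\<^sup>2 / 8"
  have \<eta>: "\<eta> > 0"
    using \<open>\<delta> > 0\<close> by (simp add: \<eta>_def)
  \<comment> \<open>The number \<open>H\<close> of shifts is fixed before \<open>N\<close>, so only
    finitely many pairs \<open>r\<close>, \<open>s\<close> compete for a threshold on
    \<open>N\<close>.\<close>
  have "\<forall>\<^sub>F H in sequentially. (\<Sum>r<H. \<Sum>s<H. cmod (\<rho> r s)) / (real H)\<^sup>2 < \<eta> \<and> H > 0"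
    using order_tendstoD(2)[OF null \<eta>] eventually_gt_at_top by (rule eventually_conj)
  then obtain H where H: "(\<Sum>r<H. \<Sum>s<H. cmod (\<rho> r s)) / (real H)\<^sup>2 < \<eta>" "H > 0"
    using eventually_happens sequentially_bot by blast
  then have H': "(\<Sum>r<H. \<Sum>s<H. cmod (\<rho> r s)) \<le> \<eta> * (real H)\<^sup>2"
    by (simp add: field_simps)
  \<comment> \<open>With \<open>K + 1\<close> in place of \<open>K\<close> there is room for the
    shift \<open>m + v\<close>, where \<open>v\<close> is at most \<open>N\<close>.\<close>
  note corr_ev = corr[unfolded cube_uniform_def, THEN spec[of _ "K + 1"], THEN spec[of _ \<eta>], THEN mp, OF \<eta>]
  have "\<forall>\<^sub>F N in sequentially. \<forall>r\<in>{..<H}. \<forall>s\<in>{..<H}. \<forall>m\<le>(K + 1) * N. \<forall>b. cube_weights J b \<longrightarrow>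
     cmod (\<Sum>n\<in>J \<rightarrow>\<^sub>E {1..N}. (c (m + (\<Sum>i\<in>J. n i) + r) * cnj (c (m + (\<Sum>i\<in>J. n i) + s)) - \<rho> r s)
       * (\<Prod>i\<in>J. b i n)) \<le> \<eta> * real N ^ card J"
    by (intro eventually_ball_finite finite_lessThan ballI corr_ev)
  moreover have "\<forall>\<^sub>F N in sequentially. 4 * C * real H / \<delta> \<le> real N"
    by (rule eventually_mono[OF eventually_ge_at_top[of "nat \<lceil>4 * C * real H / \<delta>\<rceil>"]]) linarith
  ultimately show "\<forall>\<^sub>F N in sequentially. \<forall>m\<le>K * N. \<forall>b. cube_weights (insert j J) b \<longrightarrow>
      cmod (\<Sum>n\<in>insert j J \<rightarrow>\<^sub>E {1..N}. c (m + (\<Sum>i\<in>insert j J. n i)) * (\<Prod>i\<in>insert j J. b i n))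
        \<le> \<delta> * real N ^ card (insert j J)"
  proof (eventually_elim, intro allI impI)
    fix N m b
    assume unif: "\<forall>r\<in>{..<H}. \<forall>s\<in>{..<H}. \<forall>m\<le>(K + 1) * N. \<forall>b. cube_weights J b \<longrightarrow>
       cmod (\<Sum>n\<in>J \<rightarrow>\<^sub>E {1..N}. (c (m + (\<Sum>i\<in>J. n i) + r) * cnj (c (m + (\<Sum>i\<in>J. n i) + s)) - \<rho> r s)
         * (\<Prod>i\<in>J. b i n)) \<le> \<eta> * real N ^ card J"
      and N: "4 * C * real H / \<delta> \<le> real N" and m: "m \<le> K * N" and b: "cube_weights (insert j J) b"
    have N': "2 * C * real H \<le> \<delta> / 2 * real N"
      using N \<open>\<delta> > 0\<close> by (simp add: field_simps)
    have bJ: "cube_weights J b" and bj: "cmod (b j n) \<le> 1" "b j (n(j := v)) = b j n" for n v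
      using b by (auto simp: cube_weights_def)
    define P where "P = (J \<rightarrow>\<^sub>E {1..N})"
    define p where "p = real N ^ card J"
    have P: "finite P" "real (card P) = p"
      using J by (simp_all add: P_def p_def finite_PiE card_PiE)
    have p0: "p \<ge> 0"
      by (simp add: p_def)
    \<comment> \<open>The variable \<open>n j\<close> is given the value \<open>v\<close>; the
      weight \<open>b j\<close> does not depend on it and stays outside the sum over
      \<open>v\<close>.\<close>
    define u where "u n v = c (m + (\<Sum>i\<in>J. n i) + v) * (\<Prod>i\<in>J. b i (n(j := v)))" for n v
    have ub: "cmod (u n v) \<le> C" for n v
    proof -
      have "cmod (u n v) \<le> cmod (c (m + (\<Sum>i\<in>J. n i) + v))"
        unfolding u_def norm_mult by (intro mult_right_le_one_le norm_prod_weights_le_1[OF bJ]) auto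
      then show ?thesis using bd order_trans by blast
    qed
    define X where "X = (\<Sum>n\<in>P. b j n * (\<Sum>v=1..N. u n v))"
    \<comment> \<open>Up to boundary terms, \<open>Y\<close> is \<open>H\<close> copies of
      \<open>X\<close>, one for each shift of \<open>v\<close>.\<close>
    define Y where "Y = (\<Sum>n\<in>P. b j n * (\<Sum>v=1..N. \<Sum>r<H. u n (v + r)))"
    have X_eq: "(\<Sum>n\<in>insert j J \<rightarrow>\<^sub>E {1..N}. c (m + (\<Sum>i\<in>insert j J. n i)) * (\<Prod>i\<in>insert j J. b i n)) = X"
    proof -
      have upd: "(\<Sum>i\<in>J. if i = j then v else n i) = (\<Sum>i\<in>J. n i)" for n v
        using J by (intro sum.cong) auto
      have "(\<Sum>n\<in>insert j J \<rightarrow>\<^sub>E {1..N}. c (m + (\<Sum>i\<in>insert j J. n i)) * (\<Prod>i\<in>insert j J. b i n))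
          = (\<Sum>v=1..N. \<Sum>n\<in>P. b j n * u n v)"
        using J by (simp add: sum_PiE_insert bj P_def u_def upd mult_ac add_ac)
      also have "\<dots> = X"
        unfolding X_def sum_distrib_left by (rule sum.swap)
      finally show ?thesis .
    qed
    have XY: "cmod (of_nat H * X - Y) \<le> p * (2 * C * (real H)\<^sup>2)"
    proof -
      have "of_nat H * (b j n * (\<Sum>v=1..N. u n v)) - b j n * (\<Sum>v=1..N. \<Sum>r<H. u n (v + r))
          = b j n * (\<Sum>r<H. (\<Sum>v=1..N. u n v) - (\<Sum>v=1..N. u n (v + r)))" for n
        unfolding sum.swap[of _ _ "{1..N}"] by (simp add: sum_subtractf right_diff_distrib)
      then have "of_nat H * X - Y = (\<Sum>n\<in>P. b j n * (\<Sum>r<H. (\<Sum>v=1..N. u n v) - (\<Sum>v=1..N. u n (v + r))))"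
        unfolding X_def Y_def sum_distrib_left[of "of_nat H" _ P] sum_subtractf[symmetric] by simp
      also have "cmod \<dots> \<le> (\<Sum>n\<in>P. 2 * C * (real H)\<^sup>2)"
      proof (rule sum_norm_le)
        fix n
        have C0: "C \<ge> 0" using bd[of 0] norm_ge_zero order_trans by blast
        have "cmod (\<Sum>r<H. (\<Sum>v=1..N. u n v) - (\<Sum>v=1..N. u n (v + r))) \<le> (\<Sum>r<H. 2 * C * real H)"
          using C0 by (intro sum_norm_le order_trans[OF norm_sum_shift_le[OF ub]] mult_left_mono) auto
        then have "cmod (\<Sum>r<H. (\<Sum>v=1..N. u n v) - (\<Sum>v=1..N. u n (v + r))) \<le> 2 * C * (real H)\<^sup>2"
          by (simp add: power2_eq_square mult_ac)
        then show "cmod (b j n * (\<Sum>r<H. (\<Sum>v=1..N. u n v) - (\<Sum>v=1..N. u n (v + r)))) \<le> 2 * C * (real H)\<^sup>2"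
          unfolding norm_mult by (intro order_trans[OF mult_left_le_one_le] bj norm_ge_zero)
      qed
      finally show ?thesis by (simp add: P)
    qed
    \<comment> \<open>With \<open>b j\<close> bounded by 1, the Cauchy-Schwarz inequality over the
      pairs \<open>(n, v)\<close> leaves this sum of squares.\<close>
    define Z where "Z = (\<Sum>n\<in>P. \<Sum>v=1..N. (cmod (\<Sum>r<H. u n (v + r)))\<^sup>2)"
    have YZ: "(cmod Y)\<^sup>2 \<le> (p * real N) * Z"
    proof -
      have "cmod Y \<le> (\<Sum>n\<in>P. cmod (b j n) * (\<Sum>v=1..N. cmod (\<Sum>r<H. u n (v + r))))"
        unfolding Y_def by (intro sum_norm_le) (auto simp: norm_mult intro!: mult_left_mono norm_sum)
      also have "\<dots> \<le> (\<Sum>n\<in>P. \<Sum>v=1..N. cmod (\<Sum>r<H. u n (v + r)))"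
        by (intro sum_mono mult_left_le_one_le bj sum_nonneg norm_ge_zero)
      finally have "(cmod Y)\<^sup>2 \<le> (\<Sum>q\<in>P \<times> {1..N}. cmod (\<Sum>r<H. u (fst q) (snd q + r)))\<^sup>2"
        by (intro power_mono) (auto simp: sum.cartesian_product case_prod_unfold)
      also have "\<dots> \<le> (\<Sum>q\<in>P \<times> {1..N}. (cmod (\<Sum>r<H. u (fst q) (snd q + r)))\<^sup>2) * card (P \<times> {1..N})"
        by (rule sum_squared_le_sum_of_squares)
      also have "\<dots> = (p * real N) * Z"
        by (simp add: Z_def P sum.cartesian_product case_prod_unfold card_cartesian_product)
      finally show ?thesis .
    qed
    have pair: "cmod (\<Sum>n\<in>P. u n (v + r) * cnj (u n (v + s))) \<le> p * (\<eta> + cmod (\<rho> r s))"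
      if v: "v \<in> {1..N}" and rs: "r < H" "s < H" for v r s
    proof -
      \<comment> \<open>For fixed \<open>v\<close>, \<open>r\<close>, \<open>s\<close> the
        coordinate \<open>j\<close> is frozen, and the products of the two frozen weights are again
        weights for \<open>J\<close>.\<close>
      define b' where "b' i n = b i (n(j := v + r)) * cnj (b i (n(j := v + s)))" for i n
      have b': "cube_weights J b'"
        unfolding cube_weights_def
      proof (intro ballI allI conjI)
        fix i n w assume i: "i \<in> J"
        then have "i \<noteq> j" using J by auto
        then show "b' i (n(i := w)) = b' i n"
          using bJ i by (simp add: b'_def cube_weights_def fun_upd_twist[of i j])
        show "cmod (b' i n) \<le> 1"
          using bJ i by (auto simp: b'_def norm_mult cube_weights_def intro!: mult_le_one)
      qed
      \<comment> \<open>Subtracting \<rho> makes the uniformity hypothesis applicable; the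
        subtracted part is at most \<open>cmod (\<rho> r s)\<close> at each of the \<open>p\<close>
        points.\<close>
      define W where "W n = (c ((m + v) + (\<Sum>i\<in>J. n i) + r) * cnj (c ((m + v) + (\<Sum>i\<in>J. n i) + s)) - \<rho> r s)
          * (\<Prod>i\<in>J. b' i n)" for n
      have "(\<Sum>n\<in>P. u n (v + r) * cnj (u n (v + s))) = (\<Sum>n\<in>P. W n + \<rho> r s * (\<Prod>i\<in>J. b' i n))"
        by (intro sum.cong refl) (simp add: u_def W_def b'_def prod.distrib algebra_simps)
      also have "cmod \<dots> \<le> cmod (\<Sum>n\<in>P. W n) + cmod (\<Sum>n\<in>P. \<rho> r s * (\<Prod>i\<in>J. b' i n))"
        unfolding sum.distrib by (rule norm_triangle_ineq)
      also have "\<dots> \<le> \<eta> * p + (\<Sum>n\<in>P. cmod (\<rho> r s))"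
      proof (intro add_mono)
        have "m + v \<le> (K + 1) * N"
          using m v by simp
        then show "cmod (\<Sum>n\<in>P. W n) \<le> \<eta> * p"
          using unif rs b' unfolding W_def P_def p_def by blast
        show "cmod (\<Sum>n\<in>P. \<rho> r s * (\<Prod>i\<in>J. b' i n)) \<le> (\<Sum>n\<in>P. cmod (\<rho> r s))"
          unfolding norm_mult
          by (intro sum_norm_le order_trans[OF eq_refl[OF norm_mult]] mult_right_le_one_le
              norm_prod_weights_le_1[OF b'] norm_ge_zero)
      qed
      also have "\<dots> = p * (\<eta> + cmod (\<rho> r s))"
        by (simp add: P algebra_simps)
      finally show ?thesis .
    qed
    have Z_le: "Z \<le> real N * p * (2 * \<eta> * (real H)\<^sup>2)"
    proof -
      \<comment> \<open>Expanding the squares produces the pairs \<open>r\<close>, \<open>s\<close>.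
        The sum over \<open>n\<close> is then moved innermost, where \<open>pair\<close>
        applies.\<close>
      have "complex_of_real Z = (\<Sum>n\<in>P. \<Sum>v=1..N. \<Sum>r<H. \<Sum>s<H. u n (v + r) * cnj (u n (v + s)))"
        unfolding Z_def of_real_sum
        by (intro sum.cong refl) (simp only: complex_norm_square cnj_sum sum_product)
      also have "\<dots> = (\<Sum>v=1..N. \<Sum>n\<in>P. \<Sum>r<H. \<Sum>s<H. u n (v + r) * cnj (u n (v + s)))"
        by (rule sum.swap)
      also have "\<dots> = (\<Sum>v=1..N. \<Sum>r<H. \<Sum>s<H. \<Sum>n\<in>P. u n (v + r) * cnj (u n (v + s)))"
        by (simp only: sum.swap[of _ _ P])
      also have "cmod \<dots> \<le> (\<Sum>v=1..N. \<Sum>r<H. \<Sum>s<H. p * (\<eta> + cmod (\<rho> r s)))"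
        by (intro sum_norm_le pair) auto
      also have "\<dots> = real N * p * (\<eta> * (real H)\<^sup>2 + (\<Sum>r<H. \<Sum>s<H. cmod (\<rho> r s)))"
        by (simp add: sum.distrib sum_distrib_left[symmetric] power2_eq_square algebra_simps)
      also have "\<dots> \<le> real N * p * (\<eta> * (real H)\<^sup>2 + \<eta> * (real H)\<^sup>2)"
        using H' p0 by (intro mult_left_mono add_left_mono) auto
      finally have "cmod (complex_of_real Z) \<le> real N * p * (2 * \<eta> * (real H)\<^sup>2)"
        by simp
      then show ?thesis
        by (simp only: norm_of_real)
    qed
    have "(cmod Y)\<^sup>2 \<le> (p * real N) * (real N * p * (2 * \<eta> * (real H)\<^sup>2))"
      using p0 by (intro order_trans[OF YZ] mult_left_mono Z_le) auto
    also have "\<dots> = (p * real N * real H * (\<delta> / 2))\<^sup>2"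
      by (simp add: \<eta>_def power2_eq_square)
    finally have "cmod Y \<le> p * real N * real H * (\<delta> / 2)"
      by (rule power2_le_imp_le) (use p0 \<open>\<delta> > 0\<close> in simp)
    then have "cmod (of_nat H * X) \<le> p * real N * real H * (\<delta> / 2) + p * (2 * C * (real H)\<^sup>2)"
      using XY norm_triangle_sub[of "of_nat H * X" Y] by linarith
    also have "\<dots> = real H * (p * (real N * (\<delta> / 2) + 2 * C * real H))"
      by (simp add: algebra_simps power2_eq_square)
    finally have "cmod X \<le> p * (real N * (\<delta> / 2) + 2 * C * real H)"
      using \<open>H > 0\<close> by (simp add: norm_mult)
    also have "\<dots> \<le> p * (real N * (\<delta> / 2) + \<delta> / 2 * real N)"
      using N' p0 by (intro mult_left_mono add_left_mono)
    also have "\<dots> = \<delta> * real N ^ card (insert j J)"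
      using J by (simp add: p_def field_simps)
    finally show "cmod (\<Sum>n\<in>insert j J \<rightarrow>\<^sub>E {1..N}. c (m + (\<Sum>i\<in>insert j J. n i)) * (\<Prod>i\<in>insert j J. b i n))
        \<le> \<delta> * real N ^ card (insert j J)"
      by (simp only: X_eq)
  qed
qed

text \<open>Freezing the coordinates in \<open>D\<close> turns the weights into weights for
  \<open>J\<close>, so each of the slices satisfies the bound on the smaller cube.\<close>

lemma norm_sum_superset_le:
  assumes D: "finite D" "J \<inter> D = {}"
    and bound: "\<And>b. cube_weights J b \<Longrightarrow>
      cmod (\<Sum>n\<in>J \<rightarrow>\<^sub>E A. c (\<Sum>i\<in>J. n i) * (\<Prod>i\<in>J. b i n)) \<le> B"
    and b: "cube_weights J b"
  shows "cmod (\<Sum>n\<in>J \<union> D \<rightarrow>\<^sub>E A. c (\<Sum>i\<in>J. n i) * (\<Prod>i\<in>J. b i n)) \<le> real (card A) ^ card D * B"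
  using D b
proof (induction D arbitrary: b rule: finite_induct)
  case empty
  then show ?case using bound by simp
next
  case (insert d D)
  then have d: "d \<notin> J" "d \<notin> J \<union> D" "d \<notin> D" by auto
  have upd: "(\<Sum>i\<in>J. if i = d then v else n i) = (\<Sum>i\<in>J. n i)" for n and v :: nat
    using d by (intro sum.cong) auto
  have "(\<Sum>n\<in>J \<union> insert d D \<rightarrow>\<^sub>E A. c (\<Sum>i\<in>J. n i) * (\<Prod>i\<in>J. b i n))
      = (\<Sum>v\<in>A. \<Sum>n\<in>J \<union> D \<rightarrow>\<^sub>E A. c (\<Sum>i\<in>J. n i) * (\<Prod>i\<in>J. b i (n(d := v))))"
    using d by (simp add: sum_PiE_insert upd)
  also have "cmod \<dots> \<le> (\<Sum>v\<in>A. real (card A) ^ card D * B)"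
  proof (rule sum_norm_le)
    fix v
    have "cube_weights J (\<lambda>i n. b i (n(d := v)))"
      unfolding cube_weights_def
    proof (intro ballI allI conjI)
      fix i n w assume i: "i \<in> J"
      then have "i \<noteq> d" using d by auto
      then show "b i (n(i := w, d := v)) = b i (n(d := v))"
        using insert.prems(2) i by (simp add: cube_weights_def fun_upd_twist[of i d])
      show "cmod (b i (n(d := v))) \<le> 1"
        using insert.prems(2) i by (simp add: cube_weights_def)
    qed
    then show "cmod (\<Sum>n\<in>J \<union> D \<rightarrow>\<^sub>E A. c (\<Sum>i\<in>J. n i) * (\<Prod>i\<in>J. b i (n(d := v)))) \<le> real (card A) ^ card D * B"
      using insert.prems(1) insert.IH[of "\<lambda>i n. b i (n(d := v))"] by auto
  qed
  finally show ?case
    using insert.hyps by simp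
qed

text \<open>For a vertex with support of maximal size, all other factors can be collected into
  weights on that support, and uniformity at this single vertex gives the limit.\<close>

lemma cube_uniform_imp_average_tendsto_0:
  fixes c :: "(nat \<Rightarrow> nat) \<Rightarrow> nat \<Rightarrow> complex"
  assumes S: "S \<subseteq> cube_nonzero k" "S \<noteq> {}"
    and bd: "\<And>\<epsilon> l. \<epsilon> \<in> S \<Longrightarrow> cmod (c \<epsilon> l) \<le> C" and C: "C > 0"
    and unif: "\<And>\<epsilon>. \<epsilon> \<in> S \<Longrightarrow> cube_uniform {i\<in>{1..k}. \<epsilon> i = 1} (c \<epsilon>)"
  shows "(\<lambda>N. (1 / of_nat N ^ k) *
       (\<Sum>n \<in> {1..k} \<rightarrow>\<^sub>E {1..N}. \<Prod>\<epsilon>\<in>S. c \<epsilon> (\<Sum>i=1..k. \<epsilon> i * n i))) \<longlonglongrightarrow> 0"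
proof -
  define supp where "supp \<epsilon> = {i\<in>{1..k}. \<epsilon> i = 1}" for \<epsilon> :: "nat \<Rightarrow> nat"
  have S': "S \<subseteq> {1..k} \<rightarrow>\<^sub>E {0, 1}"
    using S(1) unfolding cube_nonzero_def by blast
  then have finS: "finite S"
    by (rule finite_subset) (intro finite_PiE; simp)
  have S01: "\<eta> i = 0 \<or> \<eta> i = 1" if "\<eta> \<in> S" "i \<in> {1..k}" for \<eta> i
    using S' that by (blast dest: PiE_mem)
  obtain \<epsilon> where \<epsilon>: "\<epsilon> \<in> S" and max: "\<And>\<eta>. \<eta> \<in> S \<Longrightarrow> card (supp \<eta>) \<le> card (supp \<epsilon>)"
  proof -
    let ?c = "(\<lambda>\<eta>. card (supp \<eta>)) ` S"
    have "Max ?c \<in> ?c"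
      using finS S(2) by (intro Max_in) auto
    then obtain \<epsilon> where "\<epsilon> \<in> S" "card (supp \<epsilon>) = Max ?c"
      by force
    then show thesis
      using finS by (intro that[of \<epsilon>]) auto
  qed
  define J where "J = supp \<epsilon>"
  have J: "J \<subseteq> {1..k}" "finite J"
    by (auto simp: J_def supp_def)
  text \<open>By maximality no other vertex of \<open>S\<close> dominates \<open>\<epsilon>\<close>, so its factor is
    constant in one of the variables on which the factor of \<open>\<epsilon>\<close> depends.\<close>
  have "\<exists>i\<in>J. \<eta> i = 0" if \<eta>: "\<eta> \<in> S - {\<epsilon>}" for \<eta>
  proof (rule ccontr)
    assume "\<not> ?thesis"
    then have "J \<subseteq> supp \<eta>"
      using S01[of \<eta>] \<eta> J(1) unfolding supp_def by blast
    moreover have "finite (supp \<eta>)" by (simp add: supp_def)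
    ultimately have "J = supp \<eta>"
      using max[of \<eta>] \<eta> by (intro card_seteq) (auto simp: J_def)
    have "\<eta> = \<epsilon>"
    proof (rule PiE_ext)
      show "\<eta> \<in> {1..k} \<rightarrow>\<^sub>E {0, 1}" "\<epsilon> \<in> {1..k} \<rightarrow>\<^sub>E {0, 1}"
        using S' \<eta> \<epsilon> by blast+
      fix i assume i: "i \<in> {1..k}"
      then have "\<eta> i = 1 \<longleftrightarrow> \<epsilon> i = 1"
        using \<open>J = supp \<eta>\<close> by (auto simp: J_def supp_def)
      then show "\<eta> i = \<epsilon> i"
        using S01[OF _ i] \<eta> \<epsilon> by (metis DiffD1)
    qed
    then show False using \<eta> by simp
  qed
  \<comment> \<open>Each other vertex is assigned one coordinate of \<open>J\<close> where it
    vanishes. The weight \<open>b i\<close> collects the vertices assigned to \<open>i\<close>;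
    dividing by \<open>C\<close> brings its factors down to modulus at most 1.\<close>
  then obtain t where t: "\<And>\<eta>. \<eta> \<in> S - {\<epsilon>} \<Longrightarrow> t \<eta> \<in> J \<and> \<eta> (t \<eta>) = 0"
    by metis
  define b where "b i n = (\<Prod>\<eta>\<in>{\<eta>\<in>S - {\<epsilon>}. t \<eta> = i}. c \<eta> (\<Sum>l=1..k. \<eta> l * n l) / of_real C)" for i n
  have b: "cube_weights J b"
    unfolding cube_weights_def
  proof (intro ballI allI conjI)
    fix i n v
    show "cmod (b i n) \<le> 1"
      unfolding b_def prod_norm[symmetric] using bd C by (intro prod_le_1) (auto simp: norm_divide)
    have "(\<Sum>l=1..k. \<eta> l * (n(i := v)) l) = (\<Sum>l=1..k. \<eta> l * n l)" if "\<eta> i = 0" for \<eta> :: "nat \<Rightarrow> nat"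
      using that by (intro sum.cong) auto
    then show "b i (n(i := v)) = b i n"
      unfolding b_def using t by (intro prod.cong refl) auto
  qed
  define q where "q = card (S - {\<epsilon>})"
  have factor: "(\<Prod>\<eta>\<in>S. c \<eta> (\<Sum>i=1..k. \<eta> i * n i)) = of_real C ^ q * (c \<epsilon> (\<Sum>i\<in>J. n i) * (\<Prod>i\<in>J. b i n))" for n
  proof -
    have "(\<Prod>i\<in>J. b i n) = (\<Prod>\<eta>\<in>S - {\<epsilon>}. c \<eta> (\<Sum>l=1..k. \<eta> l * n l) / of_real C)"
      unfolding b_def using finS J t by (intro prod.group) auto
    also have "\<dots> = (\<Prod>\<eta>\<in>S - {\<epsilon>}. c \<eta> (\<Sum>l=1..k. \<eta> l * n l)) / of_real C ^ q"
      by (simp add: prod_dividef q_def)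
    finally have "(\<Prod>\<eta>\<in>S - {\<epsilon>}. c \<eta> (\<Sum>l=1..k. \<eta> l * n l)) = of_real C ^ q * (\<Prod>i\<in>J. b i n)"
      using C by simp
    moreover have "(\<Sum>i=1..k. \<epsilon> i * n i) = (\<Sum>i\<in>J. n i)"
    proof -
      have "\<epsilon> i * n i = (if i \<in> J then n i else 0)" if "i \<in> {1..k}" for i
        using S01[OF \<epsilon> that] that by (auto simp: J_def supp_def)
      then have "(\<Sum>i=1..k. \<epsilon> i * n i) = (\<Sum>i=1..k. if i \<in> J then n i else 0)"
        by (intro sum.cong refl)
      also have "\<dots> = (\<Sum>i\<in>{1..k} \<inter> J. n i)"
        by (rule sum.inter_restrict[symmetric]) simp
      also have "{1..k} \<inter> J = J"
        using J by blast
      finally show ?thesis .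
    qed
    ultimately show ?thesis
      using prod.remove[OF finS \<epsilon>, of "\<lambda>\<eta>. c \<eta> (\<Sum>i=1..k. \<eta> i * n i)"] by simp
  qed
  show ?thesis
  proof (rule tendstoI)
    fix e :: real assume "e > 0"
    define \<delta> where "\<delta> = e / (2 * C ^ q)"
    have \<delta>: "\<delta> > 0" "C ^ q * \<delta> = e / 2"
      using \<open>e > 0\<close> C by (simp_all add: \<delta>_def)
    \<comment> \<open>Uniformity is used with \<open>K = 0\<close>, that is, for the unshifted cube
      \<open>m = 0\<close>.\<close>
    have "\<forall>\<^sub>F N in sequentially. \<forall>m\<le>0 * N. \<forall>b. cube_weights J b \<longrightarrow>
       cmod (\<Sum>n\<in>J \<rightarrow>\<^sub>E {1..N}. c \<epsilon> (m + (\<Sum>i\<in>J. n i)) * (\<Prod>i\<in>J. b i n)) \<le> \<delta> * real N ^ card J"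
      using unif[OF \<epsilon>] \<delta>(1) unfolding cube_uniform_def J_def supp_def by blast
    then show "\<forall>\<^sub>F N in sequentially. dist ((1 / of_nat N ^ k) *
       (\<Sum>n \<in> {1..k} \<rightarrow>\<^sub>E {1..N}. \<Prod>\<epsilon>\<in>S. c \<epsilon> (\<Sum>i=1..k. \<epsilon> i * n i))) 0 < e"
      using eventually_gt_at_top[of 0]
    proof eventually_elim
      case (elim N)
      have "cmod (\<Sum>n\<in>J \<union> ({1..k} - J) \<rightarrow>\<^sub>E {1..N}. c \<epsilon> (\<Sum>i\<in>J. n i) * (\<Prod>i\<in>J. b i n))
          \<le> real (card {1..N}) ^ card ({1..k} - J) * (\<delta> * real N ^ card J)"
        using elim(1) by (intro norm_sum_superset_le b) auto
      moreover have "J \<union> ({1..k} - J) = {1..k}"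
        using J by auto
      moreover have "card J + card ({1..k} - J) = k"
        using J card_mono[OF _ J(1)] by (simp add: card_Diff_subset)
      ultimately have *: "cmod (\<Sum>n\<in>{1..k} \<rightarrow>\<^sub>E {1..N}. c \<epsilon> (\<Sum>i\<in>J. n i) * (\<Prod>i\<in>J. b i n)) \<le> \<delta> * real N ^ k"
        by (simp add: mult_ac flip: power_add)
      have "cmod (\<Sum>n \<in> {1..k} \<rightarrow>\<^sub>E {1..N}. \<Prod>\<epsilon>\<in>S. c \<epsilon> (\<Sum>i=1..k. \<epsilon> i * n i)) \<le> C ^ q * (\<delta> * real N ^ k)"
        unfolding factor sum_distrib_left[symmetric] norm_mult norm_power norm_of_real
        using * C by (simp add: mult_left_mono)
      also have "\<dots> = e / 2 * real N ^ k"
        using \<delta>(2) by (simp only: mult.assoc[symmetric])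
      also have "\<dots> < e * real N ^ k"
        using \<open>e > 0\<close> elim(2) by simp
      finally show ?case
        using elim(2) by (simp add: norm_mult norm_divide norm_power field_simps)
    qed
  qed
qed

subsection \<open>Convergence of the cubic averages\<close>

text \<open>In a row of the square each distance from the diagonal occurs at most twice, so the row
  sum is at most twice a sum of \<open>a\<close>. The term \<open>a 0\<close> is separate because
  Cesaro averages start at 1; divided by \<open>H\<close> it vanishes in the limit.\<close>

lemma cesaro_null_double_average:
  fixes q :: "nat \<Rightarrow> nat \<Rightarrow> real"
  assumes a: "cesaro_null a" "\<And>h. a h \<ge> 0"
    and q: "\<And>r s. q r s \<ge> 0" "\<And>r h. q r (r + h) \<le> a h" "\<And>s h. q (s + h) s \<le> a h"
  shows "(\<lambda>H. (\<Sum>r<H. \<Sum>s<H. q r s) / (real H)\<^sup>2) \<longlonglongrightarrow> 0"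
proof (rule tendsto_sandwich[of "\<lambda>_. 0"])
  have "(\<lambda>H. 2 * (a 0 / real H + (1 / real H) * (\<Sum>h=1..H. a h))) \<longlonglongrightarrow> 2 * (0 + 0)"
    using a(1) unfolding cesaro_null_def by (intro tendsto_intros lim_const_over_n)
  then show "(\<lambda>H. 2 * (a 0 / real H + (1 / real H) * (\<Sum>h=1..H. a h))) \<longlonglongrightarrow> 0"
    by simp
  show "\<forall>\<^sub>F H in sequentially. 0 \<le> (\<Sum>r<H. \<Sum>s<H. q r s) / (real H)\<^sup>2"
    using q by (intro always_eventually allI divide_nonneg_nonneg sum_nonneg) auto
  show "\<forall>\<^sub>F H in sequentially. (\<Sum>r<H. \<Sum>s<H. q r s) / (real H)\<^sup>2
      \<le> 2 * (a 0 / real H + (1 / real H) * (\<Sum>h=1..H. a h))"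
    using eventually_gt_at_top[of 0]
  proof eventually_elim
    case (elim H)
    have "(\<Sum>s<H. q r s) \<le> 2 * (a 0 + (\<Sum>h=1..H. a h))" if "r < H" for r
    proof -
      have "(\<Sum>s\<in>{r..<H}. q r s) \<le> (\<Sum>h\<in>{0..H}. a h)"
      proof (rule sum_le_included[where i = "\<lambda>h. r + h"])
        show "\<forall>s\<in>{r..<H}. \<exists>h\<in>{0..H}. r + h = s \<and> q r s \<le> a h"
        proof
          fix s assume "s \<in> {r..<H}"
          then show "\<exists>h\<in>{0..H}. r + h = s \<and> q r s \<le> a h"
            using q(2)[of r "s - r"] by (intro bexI[of _ "s - r"]) auto
        qed
      qed (use a in auto)
      moreover have "(\<Sum>s\<in>{..<r}. q r s) \<le> (\<Sum>h\<in>{0..H}. a h)"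
      proof (rule sum_le_included[where i = "\<lambda>h. r - h"])
        show "\<forall>s\<in>{..<r}. \<exists>h\<in>{0..H}. r - h = s \<and> q r s \<le> a h"
        proof
          fix s assume "s \<in> {..<r}"
          then show "\<exists>h\<in>{0..H}. r - h = s \<and> q r s \<le> a h"
            using q(3)[of s "r - s"] that by (intro bexI[of _ "r - s"]) auto
        qed
      qed (use a in auto)
      moreover have "(\<Sum>s<H. q r s) = (\<Sum>s\<in>{..<r}. q r s) + (\<Sum>s\<in>{r..<H}. q r s)"
        using that by (subst sum.union_disjoint[symmetric]) (auto intro!: sum.cong)
      moreover have "(\<Sum>h\<in>{0..H}. a h) = a 0 + (\<Sum>h=1..H. a h)"
        by (simp add: sum.atLeast_Suc_atMost)
      ultimately show ?thesis
        unfolding mult_2 by simp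
    qed
    then have "(\<Sum>r<H. \<Sum>s<H. q r s) \<le> (\<Sum>r<H. 2 * (a 0 + (\<Sum>h=1..H. a h)))"
      by (intro sum_mono) auto
    then have "(\<Sum>r<H. \<Sum>s<H. q r s) / (real H)\<^sup>2 \<le> (real H * (2 * (a 0 + (\<Sum>h=1..H. a h)))) / (real H)\<^sup>2"
      by (intro divide_right_mono) auto
    also have "\<dots> = 2 * (a 0 / real H + (1 / real H) * (\<Sum>h=1..H. a h))"
      using elim by (simp add: power2_eq_square field_simps)
    finally show ?case .
  qed
qed simp

text \<open>The exceptional set must not depend on the weights. Each induction step uses the null
  sets of countably many pairs \<open>r\<close>, \<open>s\<close>, while the weights are quantified
  inside \<open>cube_uniform\<close>.\<close>

lemma (in prob_space) AE_cube_uniform: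
  assumes T: "weakly_mixing M T" and J: "finite J" "J \<noteq> {}"
    and g: "bounded_measurable M g" "(\<integral>x. g x \<partial>M) = 0"
  shows "AE x in M. cube_uniform J (\<lambda>n. g ((T ^^ n) x))"
  using J g
proof (induction J arbitrary: g rule: finite_ne_induct)
  case (singleton j)
  obtain C where C: "\<forall>x\<in>space M. cmod (g x) \<le> C"
    using bounded_measurableD(2)[OF singleton(1)] by blast
  have "AE x in M. (\<lambda>N. (\<Sum>i<N. g ((T ^^ i) x)) / of_nat N) \<longlonglongrightarrow> 0"
    using weakly_mixing_imp_ergodic[OF T] bounded_measurableD(1)[OF singleton(1)] bspec[OF C] singleton(2)
    by (rule birkhoff)
  then show ?case
    by eventually_elim (rule cube_uniform_singleton)
next
  case (insert j J)
  have mp: "measure_preserving M T"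
    using T by (simp add: weakly_mixing_def)
  note Tn = measure_preservingD(1)[OF measure_preserving_funpow[OF mp]]
  note g = insert.prems(1)
  have gn: "bounded_measurable M (\<lambda>x. g ((T ^^ n) x))" for n
    by (rule bounded_measurable_compose[OF g Tn])
  have prod: "bounded_measurable M (\<lambda>x. g ((T ^^ r) x) * cnj (g ((T ^^ s) x)))" for r s
    by (intro bounded_measurable_mult bounded_measurable_cnj gn)
  define \<rho> where "\<rho> r s = (\<integral>x. g ((T ^^ r) x) * cnj (g ((T ^^ s) x)) \<partial>M)" for r s
  have "AE x in M. cube_uniform J (\<lambda>n. g ((T ^^ r) ((T ^^ n) x)) * cnj (g ((T ^^ s) ((T ^^ n) x))) - \<rho> r s)"
    for r s
  proof (rule insert.IH)
    show "bounded_measurable M (\<lambda>x. g ((T ^^ r) x) * cnj (g ((T ^^ s) x)) - \<rho> r s)"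
      by (intro bounded_measurable_diff prod bounded_measurable_const)
    show "(\<integral>x. g ((T ^^ r) x) * cnj (g ((T ^^ s) x)) - \<rho> r s \<partial>M) = 0"
      using integrable_bounded_measurable[OF prod] by (simp add: \<rho>_def prob_space)
  qed
  moreover have "(T ^^ r) ((T ^^ n) x) = (T ^^ (n + r)) x" for r n x
    by (simp add: add.commute[of n] funpow_add)
  ultimately have corr: "AE x in M. \<forall>r s. cube_uniform J
      (\<lambda>n. g ((T ^^ (n + r)) x) * cnj (g ((T ^^ (n + s)) x)) - \<rho> r s)"
    by (simp add: AE_all_countable)
  \<comment> \<open>By invariance of the measure only the difference \<open>h\<close> matters, and
    the product of the means in \<open>corr\<close> is 0 since \<open>g\<close> has mean zero. The
    case of a larger first index follows by conjugation.\<close>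
  have shift: "\<rho> r (r + h) = corr M T g (\<lambda>x. cnj (g x)) h" for r h
  proof -
    have "(\<lambda>x. g x * cnj (g ((T ^^ h) x))) \<in> borel_measurable M"
      using prod[of 0 h] by (simp add: bounded_measurable_def)
    from integral_measure_preserving[OF measure_preserving_funpow[OF mp, of r] this]
    show ?thesis
      by (simp add: \<rho>_def corr_def insert.prems(2) add.commute[of r] funpow_add)
  qed
  have sym: "\<rho> s r = cnj (\<rho> r s)" for r s
    unfolding \<rho>_def by (subst Bochner_Integration.integral_cnj[symmetric]) (simp add: mult.commute)
  have null: "(\<lambda>H. (\<Sum>r<H. \<Sum>s<H. cmod (\<rho> r s)) / (real H)\<^sup>2) \<longlonglongrightarrow> 0"
  proof (rule cesaro_null_double_average)
    show "cesaro_null (\<lambda>h. cmod (corr M T g (\<lambda>x. cnj (g x)) h))"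
      by (rule corr_cesaro_null[OF T g bounded_measurable_cnj[OF g]])
    show "cmod (\<rho> r (r + h)) \<le> cmod (corr M T g (\<lambda>x. cnj (g x)) h)"
      "cmod (\<rho> (r + h) r) \<le> cmod (corr M T g (\<lambda>x. cnj (g x)) h)" for r h
      by (simp_all add: shift sym[of "r + h" r])
  qed auto
  obtain C where C: "\<forall>x\<in>space M. cmod (g x) \<le> C"
    using bounded_measurableD(2)[OF g] by blast
  show ?case
    using corr AE_space
  proof eventually_elim
    case (elim x)
    \<comment> \<open>The bound holds everywhere on \<open>space M\<close>, hence at each point of
      the orbit.\<close>
    then have "cmod (g ((T ^^ n) x)) \<le> C" for n
      using C measurable_space[OF Tn] by blast
    then show ?case
      using elim insert.hyps null by (intro cube_uniform_insert[of J j _ C \<rho>]) auto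
  qed
qed

theorem theorem2:
  fixes M :: "'a measure" and k :: nat
    and T :: "(nat \<Rightarrow> nat) \<Rightarrow> 'a \<Rightarrow> 'a"
    and f :: "(nat \<Rightarrow> nat) \<Rightarrow> 'a \<Rightarrow> complex"
  assumes "prob_space M"
    and "k \<ge> 1"
    and "\<And>\<epsilon>. \<epsilon> \<in> cube_nonzero k \<Longrightarrow> weakly_mixing M (T \<epsilon>)"
    and "\<And>\<epsilon>. \<epsilon> \<in> cube_nonzero k \<Longrightarrow> f \<epsilon> \<in> borel_measurable M"
    and "\<And>\<epsilon>. \<epsilon> \<in> cube_nonzero k \<Longrightarrow> bounded (f \<epsilon> ` space M)"
  shows "AE x in M.
    (\<lambda>N. (1 / of_nat N ^ k) *
       (\<Sum>n \<in> {1..k} \<rightarrow>\<^sub>E {1..N}.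
          \<Prod>\<epsilon>\<in>cube_nonzero k. f \<epsilon> ((T \<epsilon> ^^ (\<Sum>i=1..k. \<epsilon> i * n i)) x)))
    \<longlonglongrightarrow> (\<Prod>\<epsilon>\<in>cube_nonzero k. \<integral>x. f \<epsilon> x \<partial>M)"
proof -
  interpret prob_space M by fact
  let ?V = "cube_nonzero k"
  have "finite ({1..k} \<rightarrow>\<^sub>E {0, 1::nat})"
    by (intro finite_PiE) auto
  then have finV: "finite ?V"
    by (simp add: cube_nonzero_def)
  define I where "I \<epsilon> = (\<integral>x. f \<epsilon> x \<partial>M)" for \<epsilon>
  define g where "g \<epsilon> x = f \<epsilon> x - I \<epsilon>" for \<epsilon> x
  have f: "bounded_measurable M (f \<epsilon>)" if "\<epsilon> \<in> ?V" for \<epsilon>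
    using assms(4,5)[OF that] by (auto simp: bounded_measurable_def bounded_iff)
  have g: "bounded_measurable M (g \<epsilon>)" if "\<epsilon> \<in> ?V" for \<epsilon>
    unfolding g_def by (intro bounded_measurable_diff f that bounded_measurable_const)
  have g0: "(\<integral>x. g \<epsilon> x \<partial>M) = 0" if "\<epsilon> \<in> ?V" for \<epsilon>
    using integrable_bounded_measurable[OF f[OF that]] by (simp add: g_def I_def prob_space)
  have "\<forall>\<epsilon>\<in>?V. \<exists>C>0. \<forall>x\<in>space M. cmod (g \<epsilon> x) \<le> C"
    using bounded_measurableD(2)[OF g] by blast
  then obtain B where B: "\<And>\<epsilon>. \<epsilon> \<in> ?V \<Longrightarrow> B \<epsilon> > 0 \<and> (\<forall>x\<in>space M. cmod (g \<epsilon> x) \<le> B \<epsilon>)"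
    by metis
  \<comment> \<open>A common positive bound for all the \<open>g \<epsilon>\<close>.\<close>
  define C where "C = 1 + (\<Sum>\<epsilon>\<in>?V. B \<epsilon>)"
  have BC: "B \<epsilon> \<le> C" if "\<epsilon> \<in> ?V" for \<epsilon>
    using member_le_sum[OF that _ finV, of B] B by (force simp: C_def less_imp_le)
  have C0: "C > 0"
  proof -
    have "0 \<le> (\<Sum>\<epsilon>\<in>?V. B \<epsilon>)"
      using B by (intro sum_nonneg) (simp add: less_imp_le)
    then show ?thesis by (simp add: C_def)
  qed
  have "AE x in M. cube_uniform {i\<in>{1..k}. \<epsilon> i = 1} (\<lambda>n. g \<epsilon> ((T \<epsilon> ^^ n) x))" if \<epsilon>: "\<epsilon> \<in> ?V" for \<epsilon>
  proof (rule AE_cube_uniform[OF assms(3)[OF \<epsilon>] _ _ g[OF \<epsilon>] g0[OF \<epsilon>]])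
    have \<epsilon>': "\<epsilon> \<in> {1..k} \<rightarrow>\<^sub>E {0, 1}" "\<epsilon> \<noteq> (\<lambda>i\<in>{1..k}. 0)"
      using \<epsilon> by (auto simp: cube_nonzero_def)
    show "{i\<in>{1..k}. \<epsilon> i = 1} \<noteq> {}"
    proof
      assume "{i\<in>{1..k}. \<epsilon> i = 1} = {}"
      then have "\<epsilon> i = 0" if "i \<in> {1..k}" for i
        using PiE_mem[OF \<epsilon>'(1) that] that by auto
      then have "\<epsilon> = (\<lambda>i\<in>{1..k}. 0)"
        using PiE_arb[OF \<epsilon>'(1)] by (auto simp: restrict_def)
      then show False using \<epsilon>'(2) by simp
    qed
  qed simp
  then have "AE x in M. \<forall>\<epsilon>\<in>?V. cube_uniform {i\<in>{1..k}. \<epsilon> i = 1} (\<lambda>n. g \<epsilon> ((T \<epsilon> ^^ n) x))"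
    by (intro AE_finite_allI finV)
  then show ?thesis
    using AE_space
  proof eventually_elim
    case (elim x)
    have bd: "cmod (g \<epsilon> ((T \<epsilon> ^^ l) x)) \<le> C" if "\<epsilon> \<in> ?V" for \<epsilon> l
    proof -
      have "measure_preserving M (T \<epsilon>)"
        using assms(3)[OF that] by (simp add: weakly_mixing_def)
      then have "(T \<epsilon> ^^ l) x \<in> space M"
        using elim(2) by (intro measurable_space[OF measure_preservingD(1)[OF measure_preserving_funpow]])
      then show ?thesis
        using B[OF that] BC[OF that] order_trans by blast
    qed
    \<comment> \<open>Expanding the product of the sums \<open>g \<epsilon> + I \<epsilon>\<close>
      gives one such average for each set \<open>S\<close> of vertices contributing
      \<open>g\<close>; only the empty set survives in the limit.\<close>
    define A where "A S N = (1 / of_nat N ^ k) *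
      (\<Sum>n \<in> {1..k} \<rightarrow>\<^sub>E {1..N}. \<Prod>\<epsilon>\<in>S. g \<epsilon> ((T \<epsilon> ^^ (\<Sum>i=1..k. \<epsilon> i * n i)) x))" for S N
    have A: "A S \<longlonglongrightarrow> (if S = {} then 1 else 0)" if S: "S \<in> Pow ?V" for S
    proof (cases "S = {}")
      case True
      \<comment> \<open>The empty product is 1 at each of the \<open>N ^ k\<close> points of the
        cube.\<close>
      have "A S N = 1" if "N > 0" for N
        using that True by (simp add: A_def card_PiE)
      then have "A S \<longlonglongrightarrow> 1"
        by (intro tendsto_eventually eventually_mono[OF eventually_gt_at_top[of 0]])
      then show ?thesis using True by simp
    next
      case False
      then show ?thesis
        unfolding A_def
        using cube_uniform_imp_average_tendsto_0[of S k "\<lambda>\<epsilon> l. g \<epsilon> ((T \<epsilon> ^^ l) x)" C] S bd C0 elim(1)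
        by auto
    qed
    have "(\<lambda>N. \<Sum>S\<in>Pow ?V. A S N * (\<Prod>\<epsilon>\<in>?V - S. I \<epsilon>))
        \<longlonglongrightarrow> (\<Sum>S\<in>Pow ?V. (if S = {} then 1 else 0) * (\<Prod>\<epsilon>\<in>?V - S. I \<epsilon>))"
      by (intro tendsto_sum tendsto_mult A tendsto_const)
    also have "(\<Sum>S\<in>Pow ?V. (if S = {} then 1 else 0) * (\<Prod>\<epsilon>\<in>?V - S. I \<epsilon>))
        = (\<Sum>S\<in>Pow ?V. if S = {} then (\<Prod>\<epsilon>\<in>?V. I \<epsilon>) else 0)"
      by (intro sum.cong) auto
    also have "\<dots> = (\<Prod>\<epsilon>\<in>?V. I \<epsilon>)"
      using finV by (simp add: sum.delta)
    also have "(\<lambda>N. \<Sum>S\<in>Pow ?V. A S N * (\<Prod>\<epsilon>\<in>?V - S. I \<epsilon>)) = (\<lambda>N. (1 / of_nat N ^ k) *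
       (\<Sum>n \<in> {1..k} \<rightarrow>\<^sub>E {1..N}. \<Prod>\<epsilon>\<in>?V. f \<epsilon> ((T \<epsilon> ^^ (\<Sum>i=1..k. \<epsilon> i * n i)) x)))"
    proof
      fix N
      have "(\<Prod>\<epsilon>\<in>?V. f \<epsilon> ((T \<epsilon> ^^ (\<Sum>i=1..k. \<epsilon> i * n i)) x)) =
          (\<Sum>S\<in>Pow ?V. (\<Prod>\<epsilon>\<in>S. g \<epsilon> ((T \<epsilon> ^^ (\<Sum>i=1..k. \<epsilon> i * n i)) x)) * (\<Prod>\<epsilon>\<in>?V - S. I \<epsilon>))" for n
        using prod_add[OF finV, of "\<lambda>\<epsilon>. g \<epsilon> ((T \<epsilon> ^^ (\<Sum>i=1..k. \<epsilon> i * n i)) x)" I] by (simp add: g_def)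
      then show "(\<Sum>S\<in>Pow ?V. A S N * (\<Prod>\<epsilon>\<in>?V - S. I \<epsilon>)) = (1 / of_nat N ^ k) *
         (\<Sum>n \<in> {1..k} \<rightarrow>\<^sub>E {1..N}. \<Prod>\<epsilon>\<in>?V. f \<epsilon> ((T \<epsilon> ^^ (\<Sum>i=1..k. \<epsilon> i * n i)) x))"
        by (simp only: A_def sum.swap[of _ "Pow ?V"] sum_distrib_left sum_distrib_right mult.assoc)
    qed
    finally show ?case
      by (simp add: I_def)
  qed
qed

end
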